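(* Let $R_{\mathcal{A}_5}$ be the $5\times5$ symmetric matrix with all diagonal entries $1$ and all off-diagonal entries $\frac12$, and let $R_0$ be the matrix obtained from $R_{\mathcal{A}_5}$ by replacing the $(1,2)$ and $(2,1)$ entries by $0$. Then both $R_{\mathcal{A}_5}$ and $R_0$ are reduced forms, and their solid angles satisfy $$\Omega_{\mathcal{A}_5}=0.0505862\ldots\;>\;\Omega_{R_0}=0.0479361\ldots,$$ where $\Omega_{\mathcal{A}_5}=\Omega_{R_{\mathcal{A}_5}}$. In particular, the alternating lattice $\mathcal{A}_5$ (with basis having Gram matrix $R_{\mathcal{A}_5}$) does not have the smallest solid angle among reduced bases in rank $5$.
   Context: A symmetric positive definite $n\times n$ real matrix $Q$ is called a reduced form if it is the Gram matrix of a Minkowski reduced basis, i.e. for every $1\le k\le n$ and every $x=(x_1,\dots,x_n)\in\mathbb{Z}^n$ with $\gcd(x_k,\dots,x_n)=1$ one has $q_{kk}\le x^tQx$. The solid angle $\Omega_Q$ is the $(n-1)$-dimensional spherical area of $K\cap\mathcal{S}^{n-1}$, where $\mathcal{S}^{n-1}$ is the unit sphere in $\mathbb{R}^n$ and $K=\{\sum x_iv_i: x_i\in\mathbb{R}^+\}$ for linearly independent vectors $v_1,\dots,v_n\in\mathbb{R}^n$ with Gram matrix $Q$ (it depends only on $Q$). By a formula of Hajja and Walker, $\Omega_Q=\sqrt{\det Q}\int_{\mathcal{S}}(x^tQx)^{-n/2}\,ds$, where $\mathcal{S}$ is the part of $\mathcal{S}^{n-1}$ in the positive orthant and $ds$ is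 surface area. *)

theory Defs
  imports "HOL-Analysis.Analysis"
begin

definition pos_def_sym :: "real^'n^'n \<Rightarrow> bool" where
  "pos_def_sym Q \<longleftrightarrow> transpose Q = Q \<and> (\<forall>x. x \<noteq> 0 \<longrightarrow> 0 < x \<bullet> (Q *v x))"

text \<open>The linear order on the index type plays the role of the order of the indices
  \<open>1, \<dots>, n\<close>; thus \<open>x ` {k..}\<close> is the set of the entries \<open>x\<^sub>k, \<dots>, x\<^sub>n\<close>.\<close>

definition reduced_form :: "real^('n::{finite,linorder})^('n::{finite,linorder}) \<Rightarrow> bool" where
  "reduced_form Q \<longleftrightarrow> pos_def_sym Q \<and>
     (\<forall>k. \<forall>x :: 'n \<Rightarrow> int. Gcd (x ` {k..}) = 1 \<longrightarrow>
        Q $ k $ k \<le> (\<chi> i. real_of_int (x i)) \<bullet> (Q *v (\<chi> i. real_of_int (x i))))"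

definition gram :: "('n \<Rightarrow> real^'n) \<Rightarrow> real^'n^'n" where
  "gram v = (\<chi> i j. v i \<bullet> v j)"

definition basis_family :: "('n \<Rightarrow> real^'n) \<Rightarrow> bool" where
  "basis_family v \<longleftrightarrow> inj v \<and> independent (range v)"

definition reduced_basis :: "('n::{finite,linorder} \<Rightarrow> real^('n::{finite,linorder})) \<Rightarrow> bool" where
  "reduced_basis v \<longleftrightarrow> basis_family v \<and> reduced_form (gram v)"

text \<open>Surface measure on the unit sphere, as it appears in integration in polar coordinates:
  the area of \<open>A\<close> is the dimension times the volume of the part of the unit ball lying
  over \<open>A\<close>.\<close>

definition sphere_area :: "'a::euclidean_space set \<Rightarrow> real" where
  "sphere_area A =
     real DIM('a) * measure lebesgue {t *\<^sub>R x | t x. 0 < t \<and> t \<le> 1 \<and> x \<in> A}"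

definition simplicial_cone :: "('n::finite \<Rightarrow> real^'n) \<Rightarrow> (real^'n) set" where
  "simplicial_cone v = {(\<Sum>i\<in>UNIV. c i *\<^sub>R v i) | c. \<forall>i. 0 < c i}"

definition basis_solid_angle :: "('n::finite \<Rightarrow> real^'n) \<Rightarrow> real" where
  "basis_solid_angle v = sphere_area (simplicial_cone v \<inter> sphere 0 1)"

text \<open>For positive definite \<open>Q\<close> the description is proper: a family \<open>v\<close> with Gram matrix
  \<open>Q\<close> exists and is unique up to an orthogonal transformation.\<close>

definition solid_angle :: "real^'n^'n \<Rightarrow> real" where
  "solid_angle Q =
     (THE a. \<exists>v. basis_family v \<and> gram v = Q \<and> a = basis_solid_angle v)"

definition R_A5 :: "real^5^5" where
  "R_A5 = (\<chi> i j. if i = j then 1 else 1/2)"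

text \<open>The elements of the type \<open>5\<close> are \<open>0 < 1 < 2 < 3 < 4\<close>, so the first two indices
  are \<open>0\<close> and \<open>1\<close>.\<close>

definition R_0 :: "real^5^5" where
  "R_0 = (\<chi> i j. if (i = 0 \<and> j = 1) \<or> (i = 1 \<and> j = 0) then 0 else R_A5 $ i $ j)"

end

(* In the coordinates of the basis, a simplicial cone with Gram matrix Q becomes the positive orthant,
   so its solid angle is n sqrt(det Q) times the volume of {c > 0. c.Qc <= 1}.  For both matrices
   c.Qc = (s^2 + U) / 2, where s is the sum of the coordinates and U is a form with 0 <= U <= s^2 on
   the orthant.  By homogeneity the volume is 2^(n/2) times the integral of (1 + U/s^2)^(-n/2) over the
   simplex s <= 1.  Taylor expansion of (1 + w)^(-5/2) bounds this integral from both sides by linear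
   combinations of the integrals of (U/s^2)^k.  Again by homogeneity, these are rational multiples of the
   integrals of U^k exp(-s) over the orthant, which are explicit: for a sum of r squares the
   exponential generating function is the r-th power of the sum of (2j)!/j! z^j, and a term (x - y)^2 in
   U contributes the same factor as a single square. *)

theory Submission
  imports Defs "HOL-Probability.Distributions"
begin

section \<open>Linear algebra\<close>

text \<open>The claimed decimals leave an absolute error of only 5e-8, and this shapes the
  estimates. Near the coordinate axes U/s^2 comes arbitrarily close to 1, which is the radius of
  convergence of the expansion of (1 + w)^(-5/2) about 0. From the centre 11/25 all values lie
  within 14/25, while the singularity at -1 is 36/25 away, so the convergence is geometric. A
  remainder of even order is nonnegative: the truncated polynomial is already a lower bound. For an
  upper bound the unknown factor (1 + t)^(-5/2-n) in the remainder is replaced by 1; this costs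
  accuracy and explains the longer expansions used there. The form for R_0 needs degree 20 against
  14, because its U/s^2 comes arbitrarily close to 0, whereas for R_A5 the Cauchy-Schwarz inequality
  keeps it at least 1/5. A single lemma on homogeneous integrands, applied with two different gauges
  and weights, performs every passage between the volume, the simplex and the exponential integrals,
  so surface integrals never appear.\<close>

lemma UNIV_5: "(UNIV :: 5 set) = {0, 1, 2, 3, 4}"
proof -
  have "card {0, 1, 2, 3, 4 :: 5} = CARD(5)"
    by simp
  then show ?thesis
    by (metis card_subset_eq finite subset_UNIV)
qed

lemma exhaust_5: "i = 0 \<or> i = 1 \<or> i = 2 \<or> i = 3 \<or> i = 4" for i :: 5
  using UNIV_5 by blast

lemma sum_5: "sum f (UNIV :: 5 set) = f 0 + f 1 + f 2 + f 3 + f 4"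
  unfolding UNIV_5 by (simp add: add.assoc)

lemma forall_5: "(\<forall>i::5. P i) \<longleftrightarrow> P 0 \<and> P 1 \<and> P 2 \<and> P 3 \<and> P 4"
proof -
  have "(\<forall>i::5. P i) \<longleftrightarrow> (\<forall>i\<in>{0, 1, 2, 3, 4::5}. P i)"
    using UNIV_5 by (metis UNIV_I)
  then show ?thesis by simp
qed

abbreviation orthant :: "(real^'n::finite) set" where
  "orthant \<equiv> {x. \<forall>i. 0 < x $ i}"

lemma sets_orthant [measurable]: "orthant \<in> sets (borel :: (real^'n::finite) measure)"
proof -
  have "orthant = (\<Inter>i. {x::real^'n. 0 < x $ i})"
    by auto
  also have "\<dots> \<in> sets borel"
    by (intro borel_open open_INT) (auto intro: open_halfspace_component_gt_cart)
  finally show ?thesis .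
qed

section \<open>Gram matrices and solid angles in basis coordinates\<close>

lemma quadratic_form_gram:
  fixes v :: "'n::finite \<Rightarrow> real^'n"
  shows "c \<bullet> (gram v *v c) = (norm (\<Sum>i\<in>UNIV. c $ i *\<^sub>R v i))\<^sup>2"
proof -
  have "(norm (\<Sum>i\<in>UNIV. c $ i *\<^sub>R v i))\<^sup>2
      = (\<Sum>i\<in>UNIV. \<Sum>j\<in>UNIV. c $ j * (c $ i * (v j \<bullet> v i)))"
    by (simp add: power2_norm_eq_inner inner_sum_left inner_sum_right sum_distrib_left mult.left_commute)
  also have "\<dots> = (\<Sum>i\<in>UNIV. \<Sum>j\<in>UNIV. c $ i * (c $ j * (v i \<bullet> v j)))"
    by (rule sum.swap)
  also have "\<dots> = c \<bullet> (gram v *v c)"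
    by (simp add: inner_vec_def matrix_vector_mult_def gram_def sum_distrib_left mult_ac)
  finally show ?thesis by simp
qed

lemma basis_family_iff:
  fixes v :: "'n::finite \<Rightarrow> real^'n"
  shows "basis_family v \<longleftrightarrow> (\<forall>c. (\<Sum>i\<in>UNIV. c $ i *\<^sub>R v i) = 0 \<longrightarrow> c = 0)"
proof
  assume v: "basis_family v"
  show "\<forall>c. (\<Sum>i\<in>UNIV. c $ i *\<^sub>R v i) = 0 \<longrightarrow> c = 0"
  proof (intro allI impI)
    fix c :: "real^'n"
    assume 0: "(\<Sum>i\<in>UNIV. c $ i *\<^sub>R v i) = 0"
    have inj: "inj v" and ind: "independent (range v)"
      using v by (auto simp: basis_family_def)
    have "(\<Sum>x\<in>range v. (c $ (inv v x)) *\<^sub>R x) = 0"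
      using inj 0 by (simp add: sum.reindex)
    then have "\<forall>x\<in>range v. c $ (inv v x) = 0"
      using independentD[OF ind _ order_refl, of "\<lambda>x. c $ (inv v x)"] by simp
    then show "c = 0"
      using inj by (simp add: vec_eq_iff)
  qed
next
  assume *: "\<forall>c. (\<Sum>i\<in>UNIV. c $ i *\<^sub>R v i) = 0 \<longrightarrow> c = 0"
  have inj: "inj v"
  proof (rule injI, rule ccontr)
    fix i j assume ij: "v i = v j" "i \<noteq> j"
    define c :: "real^'n" where "c = axis i 1 - axis j 1"
    have "(\<Sum>k\<in>UNIV. c $ k *\<^sub>R v k) = (\<Sum>k\<in>UNIV. (if k = i then v k else 0) - (if k = j then v k else 0))"
      unfolding c_def by (intro sum.cong) (auto simp: axis_def)
    also have "\<dots> = 0"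
      using ij by (simp add: sum_subtractf)
    finally have "c = 0" using * by blast
    then have "c $ i = 0" by simp
    then show False using ij by (simp add: c_def axis_def)
  qed
  have "independent (range v)"
  proof (rule independent_if_scalars_zero)
    fix f x assume 0: "(\<Sum>x\<in>range v. f x *\<^sub>R x) = 0" and "x \<in> range v"
    then obtain i where "x = v i" by auto
    moreover have "(\<Sum>i\<in>UNIV. (\<chi> i. f (v i)) $ i *\<^sub>R v i) = 0"
      using 0 inj by (simp add: sum.reindex)
    then have "(\<chi> i. f (v i)) = 0" using * by blast
    then have "f (v i) = 0" by (simp add: vec_eq_iff)
    ultimately show "f x = 0" by simp
  qed auto
  with inj show "basis_family v" by (simp add: basis_family_def)
qed

lemma basis_family_if_pos_def_gram:
  assumes "pos_def_sym (gram v)"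
  shows "basis_family v"
  unfolding basis_family_iff
  using assms quadratic_form_gram[of _ v] by (fastforce simp: pos_def_sym_def)

text \<open>The coordinate map carries the region of the orthant where the form is at most 1 onto
  the cone truncated by the unit ball, and the square of its Jacobian is the Gram
  determinant.\<close>

lemma basis_solid_angle_eq:
  fixes v :: "'n::{finite,wellorder} \<Rightarrow> real^('n::{finite,wellorder})"
  assumes v: "basis_family v"
  shows "basis_solid_angle v = real CARD('n) *
    (sqrt (det (gram v)) * measure lebesgue {c. (\<forall>i. 0 < c $ i) \<and> c \<bullet> (gram v *v c) \<le> 1})"
proof -
  define f where "f c = (\<Sum>i\<in>UNIV. c $ i *\<^sub>R v i)" for c
  define M where "M = (\<chi> i. v i)"
  define S where "S = {c. (\<forall>i. 0 < c $ i) \<and> c \<bullet> (gram v *v c) \<le> 1}"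
  have f_eq: "f c = transpose M *v c" for c
    by (simp add: f_def M_def vec_eq_iff matrix_vector_mult_def transpose_def mult.commute)
  have lin: "linear f"
    unfolding f_def
    by (auto intro!: linearI simp: scaleR_add_left sum.distrib scaleR_sum_right)
  have kernel: "f c = 0 \<Longrightarrow> c = 0" for c
    using v by (simp add: basis_family_iff f_def)
  have inj: "inj f"
    using kernel by (simp add: linear_injective_0[OF lin])
  have gram: "gram v = M ** transpose M"
    by (simp add: gram_def M_def vec_eq_iff matrix_matrix_mult_def transpose_def inner_vec_def)
  \<comment> \<open>The matrix of \<open>f\<close> is the transpose of \<open>M\<close>, and the
    Gram matrix is \<open>M\<close> times that transpose.\<close>
  have "(det (matrix f))\<^sup>2 = det (gram v)"
    unfolding gram f_eq[abs_def] matrix_of_matrix_vector_mul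
    by (simp add: det_mul det_transpose power2_eq_square)
  then have det: "\<bar>det (matrix f)\<bar> = sqrt (det (gram v))"
    by (metis real_sqrt_abs)
  have norm_le: "c \<bullet> (gram v *v c) \<le> 1 \<longleftrightarrow> norm (f c) \<le> 1" for c
    by (simp add: quadratic_form_gram f_def power_le_one_iff)
  have "{t *\<^sub>R x | t x. 0 < t \<and> t \<le> 1 \<and> x \<in> simplicial_cone v \<inter> sphere 0 1} = f ` S"
    (is "?L = _")
  proof (intro equalityI subsetI)
    fix y assume "y \<in> ?L"
    then obtain t c where t: "0 < t" "t \<le> 1" and c: "\<forall>i. 0 < c i"
      and y: "y = t *\<^sub>R (\<Sum>i\<in>UNIV. c i *\<^sub>R v i)" and n: "norm (\<Sum>i\<in>UNIV. c i *\<^sub>R v i) = 1"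
      by (auto simp: simplicial_cone_def)
    have y': "y = f (\<chi> i. t * c i)"
      by (simp add: y f_def scaleR_sum_right)
    have "norm y \<le> 1"
      using t n by (simp add: y)
    then show "y \<in> f ` S"
      unfolding S_def norm_le using t c y' by auto
  next
    fix y assume "y \<in> f ` S"
    then obtain c where c: "y = f c" "\<forall>i. 0 < c $ i" "norm y \<le> 1"
      by (auto simp: S_def norm_le)
    have "c \<noteq> 0"
      using c(2) by (metis zero_index less_irrefl)
    then have "0 < norm y"
      using kernel c(1) by auto
    define x where "x = (1 / norm y) *\<^sub>R y"
    have "x = (\<Sum>i\<in>UNIV. (c $ i / norm y) *\<^sub>R v i)"
      by (simp add: x_def c(1) f_def scaleR_sum_right field_simps)
    then have "x \<in> simplicial_cone v"
      unfolding simplicial_cone_def using c(2) \<open>0 < norm y\<close>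
      by (intro CollectI exI[of _ "\<lambda>i. c $ i / norm y"]) auto
    moreover have "norm x = 1" and "y = norm y *\<^sub>R x"
      using \<open>0 < norm y\<close> by (auto simp: x_def)
    ultimately show "y \<in> ?L"
      using c(3) \<open>0 < norm y\<close> by (intro CollectI exI[of _ "norm y"] exI[of _ x]) auto
  qed
  moreover have "S \<in> lmeasurable"
  proof -
    \<comment> \<open>An injective linear map is bounded below, so \<open>S\<close> is bounded and
      hence of finite measure.\<close>
    obtain B where B: "0 < B" "\<And>x. B * norm x \<le> norm (f x)"
      using linear_inj_bounded_below_pos[OF lin inj] by auto
    have "norm c \<le> 1 / B" if "c \<in> S" for c
      using that B(1) B(2)[of c] by (simp add: S_def norm_le field_simps)
    then have "bounded S"
      by (auto simp: bounded_iff)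
    moreover have "S = orthant \<inter> f -` cball 0 1"
      by (auto simp: S_def norm_le)
    moreover have "f -` cball 0 1 \<in> sets borel"
      by (intro borel_closed continuous_closed_vimage closed_cball
           linear_continuous_at linear_conv_bounded_linear[THEN iffD1] lin)
    ultimately show ?thesis
      by (intro bounded_set_imp_lmeasurable) auto
  qed
  ultimately show ?thesis
    using measure_linear_image[OF lin, of S]
    by (simp add: basis_solid_angle_def sphere_area_def det S_def)
qed

text \<open>The volume formula mentions the family only through its Gram matrix, which yields the
  uniqueness that the definite description requires.\<close>

lemma solid_angle_gram:
  fixes v :: "'n::{finite,wellorder} \<Rightarrow> real^('n::{finite,wellorder})"
  assumes "basis_family v"
  shows "solid_angle (gram v) = basis_solid_angle v"
  unfolding solid_angle_def
proof (rule the_equality)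
  show "\<exists>v'. basis_family v' \<and> gram v' = gram v \<and> basis_solid_angle v = basis_solid_angle v'"
    using assms by blast
qed (auto simp: basis_solid_angle_eq assms)


section \<open>Reducedness of the two forms\<close>

lemma reduced_form_if_integral:
  fixes Q :: "real^('n::{finite,linorder})^('n::{finite,linorder})"
  assumes Q: "pos_def_sym Q" and diag: "\<And>k. Q $ k $ k = 1"
    and int: "\<And>x. (\<And>i. x $ i \<in> \<int>) \<Longrightarrow> x \<bullet> (Q *v x) \<in> \<int>"
  shows "reduced_form Q"
  unfolding reduced_form_def
proof (intro conjI allI impI)
  fix k and x :: "'n \<Rightarrow> int"
  assume gcd: "Gcd (x ` {k..}) = 1"
  define y where "y = (\<chi> i. real_of_int (x i))"
  \<comment> \<open>A set contained in {0} has gcd 0, so gcd 1 forces a nonzero vector. Its value is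
    then a positive integer, hence at least the diagonal entry 1.\<close>
  have "y \<noteq> 0"
  proof
    assume "y = 0"
    then have "x ` {k..} \<subseteq> {0}"
      by (auto simp: y_def vec_eq_iff)
    then show False
      using gcd by (metis Gcd_0_iff zero_neq_one)
  qed
  then have "0 < y \<bullet> (Q *v y)"
    using Q by (simp add: pos_def_sym_def)
  moreover have "y \<bullet> (Q *v y) \<in> \<int>"
    by (rule int) (simp add: y_def)
  ultimately show "Q $ k $ k \<le> (\<chi> i. real_of_int (x i)) \<bullet> (Q *v (\<chi> i. real_of_int (x i)))"
    unfolding diag y_def by (auto elim!: Ints_cases)
qed (rule Q)

lemma quadratic_form_R_A5:
  "x \<bullet> (R_A5 *v x) = ((\<Sum>i\<in>UNIV. x $ i)\<^sup>2 + (\<Sum>i\<in>UNIV. (x $ i)\<^sup>2)) / 2"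
  by (simp add: inner_vec_def matrix_vector_mult_def sum_5 R_A5_def power2_eq_square algebra_simps)

text \<open>Deleting the product of the first two coordinates turns their two squares into the
  square of a difference, so the form stays a half of \<open>s\<close> squared plus a sum of
  squares.\<close>

lemma quadratic_form_R_0:
  "x \<bullet> (R_0 *v x) = ((\<Sum>i\<in>UNIV. x $ i)\<^sup>2 + ((\<Sum>i\<in>{2,3,4}. (x $ i)\<^sup>2) + (x $ 0 - x $ 1)\<^sup>2)) / 2"
  by (simp add: inner_vec_def matrix_vector_mult_def sum_5 R_A5_def R_0_def power2_eq_square algebra_simps)

lemma pos_def_sym_R_A5: "pos_def_sym R_A5"
  unfolding pos_def_sym_def
proof (intro conjI allI impI)
  show "transpose R_A5 = R_A5"
    by (simp add: R_A5_def transpose_def vec_eq_iff)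
  fix x :: "real^5" assume "x \<noteq> 0"
  then have "0 < (\<Sum>i\<in>UNIV. (x $ i)\<^sup>2)"
    by (auto simp: vec_eq_iff intro: sum_pos2)
  then show "0 < x \<bullet> (R_A5 *v x)"
    by (simp add: quadratic_form_R_A5 add_nonneg_pos)
qed

lemma pos_def_sym_R_0: "pos_def_sym R_0"
  unfolding pos_def_sym_def
proof (intro conjI allI impI)
  show "transpose R_0 = R_0"
    by (auto simp: R_0_def R_A5_def transpose_def vec_eq_iff)
  fix x :: "real^5" assume "x \<noteq> 0"
  let ?s = "\<Sum>i\<in>UNIV. x $ i"
  \<comment> \<open>The part beside \<open>?s\<close> is only semidefinite: it vanishes on the
    multiples of (1,1,0,0,0), where \<open>?s\<close> detects them.\<close>
  have "?s\<^sup>2 + ((\<Sum>i\<in>{2,3,4}. (x $ i)\<^sup>2) + (x $ 0 - x $ 1)\<^sup>2) \<noteq> 0"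
  proof
    assume *: "?s\<^sup>2 + ((\<Sum>i\<in>{2,3,4}. (x $ i)\<^sup>2) + (x $ 0 - x $ 1)\<^sup>2) = 0"
    then have "?s = 0 \<and> (x $ 2 = 0 \<and> x $ 3 = 0 \<and> x $ 4 = 0) \<and> x $ 0 = x $ 1"
      by (simp add: add_nonneg_eq_0_iff)
    then have "x = 0"
      by (simp add: sum_5 vec_eq_iff forall_5)
    with \<open>x \<noteq> 0\<close> show False ..
  qed
  then show "0 < x \<bullet> (R_0 *v x)"
    by (simp add: quadratic_form_R_0 order_less_le sum_nonneg)
qed

lemma reduced_form_R_A5: "reduced_form R_A5"
proof (rule reduced_form_if_integral[OF pos_def_sym_R_A5])
  fix x :: "real^5" assume x: "\<And>i. x $ i \<in> \<int>"
  \<comment> \<open>Each off-diagonal 1/2 occurs twice, so all coefficients are integers.\<close>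
  have "x \<bullet> (R_A5 *v x) = x $ 0 * x $ 0 + x $ 1 * x $ 1 + x $ 2 * x $ 2 + x $ 3 * x $ 3 + x $ 4 * x $ 4
    + (x $ 0 * (x $ 1 + x $ 2 + x $ 3 + x $ 4) + x $ 1 * (x $ 2 + x $ 3 + x $ 4)
    + x $ 2 * (x $ 3 + x $ 4) + x $ 3 * x $ 4)"
    by (simp add: quadratic_form_R_A5 sum_5 power2_eq_square field_simps)
  also have "\<dots> \<in> \<int>"
    by (intro Ints_add Ints_mult x)
  finally show "x \<bullet> (R_A5 *v x) \<in> \<int>" .
qed (simp add: R_A5_def)

lemma reduced_form_R_0: "reduced_form R_0"
proof (rule reduced_form_if_integral[OF pos_def_sym_R_0])
  fix x :: "real^5" assume x: "\<And>i. x $ i \<in> \<int>"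
  have "x \<bullet> (R_0 *v x) = x $ 0 * x $ 0 + x $ 1 * x $ 1 + x $ 2 * x $ 2 + x $ 3 * x $ 3 + x $ 4 * x $ 4
    + (x $ 0 * (x $ 2 + x $ 3 + x $ 4) + x $ 1 * (x $ 2 + x $ 3 + x $ 4)
    + x $ 2 * (x $ 3 + x $ 4) + x $ 3 * x $ 4)"
    by (simp add: quadratic_form_R_0 sum_5 power2_eq_square field_simps)
  also have "\<dots> \<in> \<int>"
    by (intro Ints_add Ints_mult x)
  finally show "x \<bullet> (R_0 *v x) \<in> \<int>" .
qed (auto simp: R_A5_def R_0_def)

section \<open>Taylor bounds for negative powers\<close>

text \<open>For even \<open>n\<close> both the coefficient of order \<open>n\<close> and the power
  of \<open>u - c\<close> are nonnegative, and at an intermediate point \<open>t \<ge> 0\<close> the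
  remaining factor \<open>(1 + t) powr (- a - real n)\<close> lies between 0 and 1.\<close>

lemma powr_taylor_bounds:
  fixes a c u :: real
  assumes a: "a > 0" and n: "even n" "n > 0" and cu: "0 \<le> c" "0 \<le> u"
  defines "T \<equiv> (\<Sum>m<n. ((- a) gchoose m) * (1 + c) powr (- a - real m) * (u - c) ^ m)"
  shows "T \<le> (1 + u) powr (- a)" and "(1 + u) powr (- a) \<le> T + ((- a) gchoose n) * (u - c) ^ n"
proof -
  define d where "d m t = (\<Prod>i<m. - a - real i) * (1 + t) powr (- a - real m)" for m t
  have coeff: "((- a) gchoose m) = (\<Prod>i<m. - a - real i) / fact m" for m
    by (simp add: gbinomial_prod_rev atLeast0LessThan)
  have coeff_nonneg: "0 \<le> ((- a) gchoose n)"
  proof -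
    have "(\<Prod>i<n. - a - real i) = (\<Prod>i<n. (-1) * (a + real i))"
      by (intro prod.cong) auto
    also have "\<dots> = (\<Prod>i<n. a + real i)"
      using n by (simp only: prod.distrib) simp
    finally show ?thesis
      using a by (simp add: coeff prod_nonneg)
  qed
  \<comment> \<open>The theorem of Taylor requires \<open>u\<close> to differ from the centre; at
    the centre all terms of positive order vanish and any \<open>t\<close> serves.\<close>
  have "\<exists>t\<ge>0. (1 + u) powr (- a) = T + ((- a) gchoose n) * (1 + t) powr (- a - real n) * (u - c) ^ n"
  proof (cases "u = c")
    case True
    have "T = (\<Sum>m\<in>{0}. ((- a) gchoose m) * (1 + c) powr (- a - real m) * (u - c) ^ m)"
      unfolding T_def using n True by (intro sum.mono_neutral_right) auto
    then show ?thesis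
      using True n by (intro exI[of _ 0]) simp
  next
    case False
    have "\<exists>t. (if u < c then u < t \<and> t < c else c < t \<and> t < u) \<and>
      (1 + u) powr (- a) = (\<Sum>m<n. d m c / fact m * (u - c) ^ m) + d n t / fact n * (u - c) ^ n"
    proof (rule Taylor[where a = 0 and b = "max u c" and diff = d])
      show "\<forall>m t. m < n \<and> 0 \<le> t \<and> t \<le> max u c \<longrightarrow> (d m has_real_derivative d (Suc m) t) (at t)"
      proof (intro allI impI)
        fix m and t :: real assume "m < n \<and> 0 \<le> t \<and> t \<le> max u c"
        then show "(d m has_real_derivative d (Suc m) t) (at t)"
          unfolding d_def by (auto intro!: derivative_eq_intros simp: algebra_simps)
      qed
    qed (use n cu False in \<open>auto simp: d_def\<close>)
    then obtain t where t: "if u < c then u < t \<and> t < c else c < t \<and> t < u"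
      and eq: "(1 + u) powr (- a) = (\<Sum>m<n. d m c / fact m * (u - c) ^ m) + d n t / fact n * (u - c) ^ n"
      by blast
    have "t \<ge> 0"
      using t cu by (simp split: if_splits)
    with eq show ?thesis
      by (intro exI[of _ t]) (simp add: T_def d_def coeff)
  qed
  then obtain t where t: "t \<ge> 0"
    "(1 + u) powr (- a) = T + ((- a) gchoose n) * (1 + t) powr (- a - real n) * (u - c) ^ n"
    by blast
  have pow: "0 \<le> (u - c) ^ n"
    using n by (simp add: zero_le_even_power)
  show "T \<le> (1 + u) powr (- a)"
    using t pow coeff_nonneg by simp
  have "(1 + t) powr (- a - real n) \<le> (1 + t) powr 0"
    using t(1) a by (intro powr_mono) auto
  then have "((- a) gchoose n) * (1 + t) powr (- a - real n) \<le> ((- a) gchoose n) * 1"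
    using coeff_nonneg t(1) by (intro mult_left_mono) auto
  then show "(1 + u) powr (- a) \<le> T + ((- a) gchoose n) * (u - c) ^ n"
    using pow unfolding t(2) by (simp add: mult_right_mono)
qed

section \<open>Integrals of homogeneous functions over cones\<close>

lemma nn_integral_lborel_scale:
  fixes f :: "'a::euclidean_space \<Rightarrow> ennreal"
  assumes [measurable]: "f \<in> borel_measurable borel" and a: "a > 0"
  shows "(\<integral>\<^sup>+x. f x \<partial>lborel) = ennreal (a ^ DIM('a)) * (\<integral>\<^sup>+x. f (a *\<^sub>R x) \<partial>lborel)"
  using a by (subst lborel_affine[of a 0])
    (simp_all add: nn_integral_density nn_integral_distr nn_integral_cmult)

lemma nn_integral_powr_tail:
  fixes a :: real
  assumes a: "a > 0" and n: "n > 0"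
  shows "(\<integral>\<^sup>+t. ennreal (1 / t ^ Suc n) * indicator {a..} t \<partial>lborel) = ennreal (1 / (real n * a ^ n))"
proof -
  have "(\<integral>\<^sup>+t. ennreal (1 / t ^ Suc n) * indicator {a..} t \<partial>lborel)
      = ennreal (0 - - (1 / (real n * a ^ n)))"
  proof (rule nn_integral_FTC_atLeast)
    show "((\<lambda>t. - (1 / (real n * t ^ n))) has_real_derivative 1 / x ^ Suc n) (at x)" if "a \<le> x" for x
    proof -
      have "((\<lambda>t. - (1 / real n) * t powi (- int n)) has_real_derivative
          - (1 / real n) * (real_of_int (- int n) * x powi (- int n - 1) * 1)) (at x)"
        using that a by (intro DERIV_cmult DERIV_power_int DERIV_ident) auto
      moreover have "- int n - 1 = - int (Suc n)"
        by simp
      ultimately show ?thesis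
        using n by (simp add: power_int_minus power_int_of_nat divide_inverse mult.assoc[symmetric] del: of_nat_Suc)
    qed
    have "((\<lambda>t::real. 1 / t ^ n) \<longlongrightarrow> 0) at_top"
      using n by (intro tendsto_divide_0[OF tendsto_const] filterlim_at_top_imp_at_infinity
          filterlim_pow_at_top filterlim_ident) auto
    from tendsto_mult[OF tendsto_const[of "- 1 / real n"] this]
    show "((\<lambda>t. - (1 / (real n * t ^ n))) \<longlongrightarrow> 0) at_top"
      by simp
  qed (use a in auto)
  then show ?thesis by simp
qed

text \<open>Homogeneity turns the integral over \<open>N \<le> 1\<close> into one weighted by any function of another
  gauge \<open>s\<close>: insert \<open>1 = K\<inverse> \<integral> s(x) \<Psi>(s(x) t) dt\<close>, exchange the integrals and rescale \<open>x\<close> by \<open>1/t\<close>.\<close>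

lemma nn_integral_homogeneous:
  fixes A :: "'a::euclidean_space set" and N s :: "'a \<Rightarrow> real"
    and H :: "'a \<Rightarrow> ennreal" and \<psi> :: "real \<Rightarrow> ennreal"
  assumes [measurable]: "A \<in> sets borel" "N \<in> borel_measurable borel" "s \<in> borel_measurable borel"
      "H \<in> borel_measurable borel" "\<psi> \<in> borel_measurable borel"
    and A: "\<And>t x. 0 < t \<Longrightarrow> x \<in> A \<Longrightarrow> t *\<^sub>R x \<in> A"
    and N: "\<And>x. x \<in> A \<Longrightarrow> 0 < N x" "\<And>t x. 0 < t \<Longrightarrow> x \<in> A \<Longrightarrow> N (t *\<^sub>R x) = t * N x"
    and s: "\<And>x. x \<in> A \<Longrightarrow> 0 < s x" "\<And>t x. 0 < t \<Longrightarrow> x \<in> A \<Longrightarrow> s (t *\<^sub>R x) = t * s x"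
    and H: "\<And>t x. 0 < t \<Longrightarrow> x \<in> A \<Longrightarrow> H (t *\<^sub>R x) = H x"
  shows "(\<integral>\<^sup>+x. H x * indicator A x * indicator {..1} (N x) \<partial>lborel) *
      (\<integral>\<^sup>+r. \<psi> r * ennreal (r ^ (DIM('a) - 1)) * indicator {0<..} r \<partial>lborel)
    = (\<integral>\<^sup>+x. H x * indicator A x * (ennreal ((s x / N x) ^ DIM('a) / DIM('a)) * \<psi> (s x)) \<partial>lborel)"
proof -
  let ?d = "DIM('a)"
  define \<Psi> where "\<Psi> r = \<psi> r * ennreal (r ^ (?d - 1)) * indicator {0<..} r" for r
  have [measurable]: "\<Psi> \<in> borel_measurable borel"
    unfolding \<Psi>_def by measurable
  define K where "K = (\<integral>\<^sup>+r. \<Psi> r \<partial>lborel)"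
  define G where "G x t = H x * indicator A x * indicator {..1} (N x) * (ennreal (s x) * \<Psi> (s x * t))" for x t
  define G' where "G' x t = H x * indicator A x * (ennreal (s x) * \<Psi> (s x)) * (ennreal (1 / t ^ Suc ?d) * indicator {N x..} t)" for x t
  have scale_A: "t *\<^sub>R x \<in> A \<longleftrightarrow> x \<in> A" if "0 < t" for t x
    using A[of t x] A[of "1 / t" "t *\<^sub>R x"] that by auto
  \<comment> \<open>Replacing x by x/t gives a factor \<open>1 / t ^ ?d\<close> from the volume and
    one more 1/t from \<open>s\<close>, and turns the constraint N(x/t) \<le> 1 into t \<ge> N x. In
    \<open>G'\<close> the variable t is thereby separated from the weight.\<close>
  have inner: "(\<integral>\<^sup>+x. G x t \<partial>lborel) = (\<integral>\<^sup>+x. G' x t \<partial>lborel)" for t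
  proof (cases "t > 0")
    case True
    have "(\<integral>\<^sup>+x. G x t \<partial>lborel) = ennreal ((1 / t) ^ ?d) * (\<integral>\<^sup>+x. G ((1 / t) *\<^sub>R x) t \<partial>lborel)"
      using True by (intro nn_integral_lborel_scale) (auto simp: G_def)
    also have "\<dots> = (\<integral>\<^sup>+x. ennreal ((1 / t) ^ ?d) * G ((1 / t) *\<^sub>R x) t \<partial>lborel)"
      by (rule nn_integral_cmult[symmetric]) (auto simp: G_def)
    also have "\<dots> = (\<integral>\<^sup>+x. G' x t \<partial>lborel)"
    proof (intro nn_integral_cong)
      fix x :: 'a
      show "ennreal ((1 / t) ^ ?d) * G ((1 / t) *\<^sub>R x) t = G' x t"
      proof (cases "x \<in> A")
        case x: True
        have "ennreal ((1 / t) ^ ?d) * G ((1 / t) *\<^sub>R x) t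
          = ennreal ((1 / t) ^ ?d) * (H x * indicator {..1} (1 / t * N x) * (ennreal (1 / t * s x) * \<Psi> (s x)))"
          using True x H[of "1 / t" x] N(2)[of "1 / t" x] s(2)[of "1 / t" x] scale_A[of "1 / t" x]
          by (simp add: G_def)
        also have "ennreal (1 / t * s x) = ennreal (1 / t) * ennreal (s x)"
          using True s(1)[OF x] by (intro ennreal_mult) auto
        also have "indicator {..1} (1 / t * N x) = (indicator {N x..} t :: ennreal)"
          using True by (auto simp: indicator_def field_simps)
        also have "ennreal ((1 / t) ^ ?d) * (H x * indicator {N x..} t * (ennreal (1 / t) * ennreal (s x) * \<Psi> (s x)))
          = H x * (ennreal (s x) * \<Psi> (s x)) * ((ennreal ((1 / t) ^ ?d) * ennreal (1 / t)) * indicator {N x..} t)"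
          by (simp only: mult_ac)
        also have "ennreal ((1 / t) ^ ?d) * ennreal (1 / t) = ennreal (1 / t ^ Suc ?d)"
          using True by (subst ennreal_mult[symmetric]) (auto simp: power_divide)
        finally show ?thesis using x by (simp add: G'_def)
      next
        case False
        then show ?thesis
          using True scale_A[of "1 / t" x] by (simp add: G_def G'_def)
      qed
    qed
    finally show ?thesis .
  next
    case False
    \<comment> \<open>For t \<le> 0 one side vanishes by the cut-off in the weight, the other
      because \<open>N\<close> is positive on \<open>A\<close>.\<close>
    have 1: "G x t = 0" for x
      using False s(1)[of x] by (auto simp: G_def \<Psi>_def indicator_def zero_less_mult_iff)
    have 2: "G' x t = 0" for x
      using False N(1)[of x] by (auto simp: G'_def indicator_def)
    show ?thesis unfolding 1 2 ..
  qed
  have "(\<integral>\<^sup>+x. H x * indicator A x * indicator {..1} (N x) \<partial>lborel) * K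
      = (\<integral>\<^sup>+x. H x * indicator A x * indicator {..1} (N x) * K \<partial>lborel)"
    by (rule nn_integral_multc[symmetric]) auto
  also have "\<dots> = (\<integral>\<^sup>+x. \<integral>\<^sup>+t. G x t \<partial>lborel \<partial>lborel)"
  proof (intro nn_integral_cong)
    fix x :: 'a
    show "H x * indicator A x * indicator {..1} (N x) * K = (\<integral>\<^sup>+t. G x t \<partial>lborel)"
    proof (cases "x \<in> A")
      case True
      have "K = (\<integral>\<^sup>+t. ennreal (s x) * \<Psi> (s x * t) \<partial>lborel)"
        unfolding K_def using s(1)[OF True]
        by (subst nn_integral_real_affine[where c = "s x" and t = 0]) (auto simp: nn_integral_cmult)
      then show ?thesis
        unfolding G_def by (subst nn_integral_cmult) auto
    qed (simp add: G_def)
  qed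
  also have "\<dots> = (\<integral>\<^sup>+t. \<integral>\<^sup>+x. G x t \<partial>lborel \<partial>lborel)"
    by (rule lborel_pair.Fubini'[symmetric]) (simp add: G_def)
  also have "\<dots> = (\<integral>\<^sup>+t. \<integral>\<^sup>+x. G' x t \<partial>lborel \<partial>lborel)"
    by (simp only: inner)
  also have "\<dots> = (\<integral>\<^sup>+x. \<integral>\<^sup>+t. G' x t \<partial>lborel \<partial>lborel)"
    by (rule lborel_pair.Fubini') (simp add: G'_def indicator_def)
  also have "\<dots> = (\<integral>\<^sup>+x. H x * indicator A x * (ennreal ((s x / N x) ^ ?d / ?d) * \<psi> (s x)) \<partial>lborel)"
  proof (intro nn_integral_cong)
    fix x :: 'a
    show "(\<integral>\<^sup>+t. G' x t \<partial>lborel) = H x * indicator A x * (ennreal ((s x / N x) ^ ?d / ?d) * \<psi> (s x))"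
    proof (cases "x \<in> A")
      case True
      have "(\<integral>\<^sup>+t. G' x t \<partial>lborel) = H x * (ennreal (s x) * \<Psi> (s x)) *
          (\<integral>\<^sup>+t. ennreal (1 / t ^ Suc ?d) * indicator {N x..} t \<partial>lborel)"
        unfolding G'_def using True by (subst nn_integral_cmult) auto
      also have "(\<integral>\<^sup>+t. ennreal (1 / t ^ Suc ?d) * indicator {N x..} t \<partial>lborel) = ennreal (1 / (?d * N x ^ ?d))"
        by (rule nn_integral_powr_tail) (use N(1)[OF True] in auto)
      also have "H x * (ennreal (s x) * \<Psi> (s x)) * ennreal (1 / (?d * N x ^ ?d))
        = H x * ((ennreal (s x) * ennreal (s x ^ (?d - 1)) * ennreal (1 / (?d * N x ^ ?d))) * \<psi> (s x))"
        using s(1)[OF True] by (simp add: \<Psi>_def mult_ac)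
      also have "ennreal (s x) * ennreal (s x ^ (?d - 1)) = ennreal (s x ^ ?d)"
        using s(1)[OF True] by (subst ennreal_mult[symmetric]) (auto simp: power_Suc[symmetric] simp del: power_Suc)
      also have "ennreal (s x ^ ?d) * ennreal (1 / (?d * N x ^ ?d)) = ennreal ((s x / N x) ^ ?d / ?d)"
        using s(1)[OF True] N(1)[OF True]
        by (subst ennreal_mult[symmetric]) (auto simp: power_divide field_simps)
      finally show ?thesis using True by simp
    qed (simp add: G'_def)
  qed
  finally show ?thesis
    by (simp add: K_def \<Psi>_def)
qed

section \<open>Exponential moments over the orthant\<close>

lemma nn_integral_power_times_exp:
  "(\<integral>\<^sup>+x. ennreal (indicator {0<..} x * (x ^ k * exp (- x))) \<partial>lborel) = ennreal (fact k)"
proof -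
  have "(\<integral>\<^sup>+x. ennreal (indicator {0<..} x * (x ^ k * exp (- x))) \<partial>lborel)
      = (\<integral>\<^sup>+x. ennreal (x ^ k * exp (- x)) * indicator {0..} x \<partial>lborel)"
    by (intro nn_integral_cong_AE eventually_mono[OF AE_lborel_singleton[of 0]])
       (auto simp: indicator_def)
  then show ?thesis
    using nn_intergal_power_times_exp_Ici[of k] by simp
qed

lemma prod_Basis_cart:
  "(\<Prod>b\<in>Basis. f b) = (\<Prod>i\<in>UNIV. f (axis i 1 :: real^'n::finite))"
proof -
  have *: "Basis = range (\<lambda>i. axis i 1 :: real^'n)"
    by (auto simp: Basis_vec_def)
  show ?thesis
    unfolding * by (subst prod.reindex) (auto simp: inj_on_def axis_eq_axis)
qed

lemma has_bochner_integral_monomial_exp: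
  fixes a :: "'n::finite \<Rightarrow> nat"
  shows "has_bochner_integral lborel
    (\<lambda>x::real^'n. indicator orthant x * exp (- (\<Sum>i\<in>UNIV. x $ i)) * (\<Prod>i\<in>UNIV. x $ i ^ a i))
    (\<Prod>i\<in>UNIV. fact (a i))"
proof (rule has_bochner_integral_nn_integral)
  have cont: "continuous_on UNIV (\<lambda>x::real^'n. exp (- (\<Sum>i\<in>UNIV. x $ i)) * (\<Prod>i\<in>UNIV. x $ i ^ a i))"
    by (intro continuous_intros)
  have [measurable]: "(\<lambda>x::real^'n. exp (- (\<Sum>i\<in>UNIV. x $ i)) * (\<Prod>i\<in>UNIV. x $ i ^ a i)) \<in> borel_measurable borel"
    by (rule borel_measurable_continuous_onI[OF cont])
  show "(\<lambda>x::real^'n. indicator orthant x * exp (- (\<Sum>i\<in>UNIV. x $ i)) * (\<Prod>i\<in>UNIV. x $ i ^ a i))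
      \<in> borel_measurable lborel"
    unfolding mult.assoc by measurable
  show "AE x::real^'n in lborel. 0 \<le> indicator orthant x * exp (- (\<Sum>i\<in>UNIV. x $ i)) * (\<Prod>i\<in>UNIV. x $ i ^ a i)"
    by (intro AE_I2) (simp add: indicator_def prod_nonneg less_imp_le)
  \<comment> \<open>The product formula for Lebesgue measure runs over basis vectors;
    \<open>ix\<close> recovers the coordinate index that selects the exponent.\<close>
  define ix :: "real^'n \<Rightarrow> 'n" where "ix b = (THE i. b = axis i 1)" for b
  have ix: "ix (axis i 1) = i" for i
    unfolding ix_def by (auto simp: axis_eq_axis)
  define g where "g b y = indicator {0<..} y * (y ^ a (ix b) * exp (- y))" for b and y :: real
  have eq: "indicator orthant x * exp (- (\<Sum>i\<in>UNIV. x $ i)) * (\<Prod>i\<in>UNIV. x $ i ^ a i)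
     = (\<Prod>b\<in>Basis. g b (x \<bullet> b))" for x :: "real^'n"
  proof -
    have "(\<Prod>i\<in>UNIV. indicator {0<..} (x $ i)) = (indicator orthant x :: real)"
      by (cases "x \<in> orthant") (auto simp: indicator_def not_less)
    moreover have "(\<Prod>i\<in>UNIV. exp (- (x $ i))) = exp (- (\<Sum>i\<in>UNIV. x $ i))"
      by (simp add: exp_sum sum_negf[symmetric])
    ultimately show ?thesis
      by (simp add: prod_Basis_cart g_def ix inner_axis prod.distrib)
  qed
  have "(\<integral>\<^sup>+x. ennreal (\<Prod>b\<in>Basis. g b (x \<bullet> b)) \<partial>lborel) = (\<integral>\<^sup>+x. (\<Prod>b\<in>Basis. ennreal (g b (x \<bullet> b))) \<partial>(lborel :: (real^'n) measure))"
    by (intro nn_integral_cong) (subst prod_ennreal, auto simp: g_def indicator_def)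
  also have "\<dots> = (\<Prod>b\<in>(Basis :: (real^'n) set). \<integral>\<^sup>+y. ennreal (g b y) \<partial>lborel)"
    by (rule nn_integral_lborel_prod) (auto simp: g_def)
  also have "\<dots> = (\<Prod>i\<in>UNIV. ennreal (fact (a i)))"
    unfolding prod_Basis_cart g_def ix nn_integral_power_times_exp ..
  also have "\<dots> = ennreal (\<Prod>i\<in>UNIV. fact (a i))"
    by (intro prod_ennreal) auto
  finally show "(\<integral>\<^sup>+x. ennreal (indicator orthant x * exp (- (\<Sum>i\<in>UNIV. x $ i)) * (\<Prod>i\<in>UNIV. x $ i ^ a i)) \<partial>lborel)
      = ennreal (\<Prod>i\<in>UNIV. fact (a i))" for x :: "real^'n"
    unfolding eq .
qed (simp add: prod_nonneg)

text \<open>Formally the expectation of exp(z X^2) for a standard exponential variable X. The series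
  has radius of convergence 0, so it is used only as a formal power series.\<close>

definition square_series :: "real fps" where
  "square_series = Abs_fps (\<lambda>j. fact (2 * j) / fact j)"

text \<open>Scaling by factorials turns the Cauchy product into a binomial convolution, the shape in
  which the binomial theorem splits one square off a sum.\<close>

lemma square_series_Suc:
  "fact k * fps_nth (square_series ^ Suc r) k
    = (\<Sum>j\<le>k. real (k choose j) * (fact (2 * j) * (fact (k - j) * fps_nth (square_series ^ r) (k - j))))"
  unfolding power_Suc fps_mult_nth atMost_atLeast0 sum_distrib_left
  by (intro sum.cong) (auto simp: square_series_def binomial_fact field_simps)

abbreviation exp_weight :: "real^'n::finite \<Rightarrow> real" where
  "exp_weight x \<equiv> indicator orthant x * exp (- (\<Sum>i\<in>UNIV. x $ i))"

text \<open>The monomial in the coordinates outside \<open>I\<close> makes the induction work: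
  expanding the power for \<open>insert i I\<close> moves an even power of the new coordinate into
  the monomial for \<open>I\<close>. It also supplies the mixed terms of the squared difference
  below.\<close>

lemma has_bochner_integral_sum_squares_exp:
  fixes I :: "'n::finite set"
  shows "has_bochner_integral lborel
    (\<lambda>x::real^'n. exp_weight x * ((\<Prod>i\<in>-I. x $ i ^ a i) * (\<Sum>i\<in>I. (x $ i)\<^sup>2) ^ k))
    ((\<Prod>i\<in>-I. fact (a i)) * (fact k * fps_nth (square_series ^ card I) k))"
  using finite[of I]
proof (induction I arbitrary: a k rule: finite_induct)
  case empty
  \<comment> \<open>The empty sum to the power \<open>k\<close> is 1 for \<open>k = 0\<close> and 0
    otherwise, as are the coefficients of the zeroth power of the series.\<close>
  show ?case
    using has_bochner_integral_mult_left[OF has_bochner_integral_monomial_exp[of a], of "0 ^ k"]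
    by (cases "k = 0") (simp_all add: mult.commute power_0_left)
next
  case (insert i I)
  have compl: "- I = insert i (- insert i I)"
    using insert by auto
  let ?f = "\<lambda>j x. real (k choose j) * (exp_weight x * ((\<Prod>l\<in>-I. x $ l ^ (a(i := 2 * j)) l) * (\<Sum>i\<in>I. (x $ i)\<^sup>2) ^ (k - j)))"
  have "has_bochner_integral lborel (\<lambda>x. \<Sum>j\<le>k. ?f j x)
      (\<Sum>j\<le>k. real (k choose j) * ((\<Prod>l\<in>-I. fact ((a(i := 2 * j)) l)) * (fact (k - j) * fps_nth (square_series ^ card I) (k - j))))"
    by (intro has_bochner_integral_sum has_bochner_integral_mult_right insert.IH)
  also have "(\<lambda>x. \<Sum>j\<le>k. ?f j x) =
      (\<lambda>x. exp_weight x * ((\<Prod>l\<in>-insert i I. x $ l ^ a l) * (\<Sum>l\<in>insert i I. (x $ l)\<^sup>2) ^ k))"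
  proof
    fix x :: "real^'n"
    have "(\<Prod>l\<in>-I. x $ l ^ (a(i := 2 * j)) l) = ((x $ i)\<^sup>2) ^ j * (\<Prod>l\<in>-insert i I. x $ l ^ a l)" for j
      unfolding compl by (subst prod.insert) (auto simp: power_mult intro!: prod.cong)
    then show "(\<Sum>j\<le>k. ?f j x) = exp_weight x * ((\<Prod>l\<in>-insert i I. x $ l ^ a l) * (\<Sum>l\<in>insert i I. (x $ l)\<^sup>2) ^ k)"
      using insert by (simp add: binomial_ring sum_distrib_left mult_ac)
  qed
  also have "(\<Sum>j\<le>k. real (k choose j) * ((\<Prod>l\<in>-I. fact ((a(i := 2 * j)) l)) * (fact (k - j) * fps_nth (square_series ^ card I) (k - j))))
     = (\<Prod>l\<in>-insert i I. fact (a l)) * (fact k * fps_nth (square_series ^ card (insert i I)) k)"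
  proof -
    have "(\<Prod>l\<in>-I. fact ((a(i := 2 * j)) l)) = fact (2 * j) * (\<Prod>l\<in>-insert i I. fact (a l) :: real)" for j
      unfolding compl by (subst prod.insert) (auto intro!: prod.cong)
    then show ?thesis
      using insert by (simp add: square_series_Suc sum_distrib_left mult_ac del: power_Suc)
  qed
  finally show ?case .
qed

text \<open>The absolute difference of two independent standard exponential variables is again
  standard exponential, so the squared difference has the moments of a single square. Here this
  appears as an alternating sum of equal terms.\<close>

lemma has_bochner_integral_sum_squares_diff_exp:
  fixes I :: "'n::finite set"
  assumes I: "- I = {p, q}" "p \<noteq> q"
  shows "has_bochner_integral lborel
    (\<lambda>x::real^'n. exp_weight x * ((\<Sum>i\<in>I. (x $ i)\<^sup>2) + (x $ p - x $ q)\<^sup>2) ^ k)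
    (fact k * fps_nth (square_series ^ Suc (card I)) k)"
proof -
  \<comment> \<open>On the complement \<open>{p, q}\<close> the exponents are l at \<open>p\<close>
    and 2j - l at \<open>q\<close>; the default value is read only at \<open>q\<close>.\<close>
  let ?a = "\<lambda>j l. (\<lambda>_. 2 * j - l)(p := l)"
  let ?c = "\<lambda>j l. real (k choose j) * (real (2 * j choose l) * (-1) ^ (2 * j - l))"
  let ?f = "\<lambda>j l x. ?c j l * (exp_weight x * ((\<Prod>i\<in>-I. x $ i ^ ?a j l i) * (\<Sum>i\<in>I. (x $ i)\<^sup>2) ^ (k - j)))"
  have "has_bochner_integral lborel (\<lambda>x. \<Sum>j\<le>k. \<Sum>l\<le>2 * j. ?f j l x)
      (\<Sum>j\<le>k. \<Sum>l\<le>2 * j. ?c j l * ((\<Prod>i\<in>-I. fact (?a j l i)) * (fact (k - j) * fps_nth (square_series ^ card I) (k - j))))"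
    by (intro has_bochner_integral_sum has_bochner_integral_mult_right has_bochner_integral_sum_squares_exp)
  also have "(\<lambda>x. \<Sum>j\<le>k. \<Sum>l\<le>2 * j. ?f j l x) =
      (\<lambda>x. exp_weight x * ((\<Sum>i\<in>I. (x $ i)\<^sup>2) + (x $ p - x $ q)\<^sup>2) ^ k)"
  proof
    fix x :: "real^'n"
    have "(x $ p - x $ q) ^ (2 * j) = (\<Sum>l\<le>2 * j. real (2 * j choose l) * (-1) ^ (2 * j - l) * (\<Prod>i\<in>-I. x $ i ^ ?a j l i))" for j
      unfolding diff_conv_add_uminus binomial_ring using I
      by (intro sum.cong) (auto simp: power_minus[of "x $ q"])
    then show "(\<Sum>j\<le>k. \<Sum>l\<le>2 * j. ?f j l x) = exp_weight x * ((\<Sum>i\<in>I. (x $ i)\<^sup>2) + (x $ p - x $ q)\<^sup>2) ^ k"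
      by (simp add: add.commute[of "\<Sum>i\<in>I. (x $ i)\<^sup>2"] binomial_ring sum_distrib_left sum_distrib_right power_mult[symmetric] mult_ac)
  qed
  also have "(\<Sum>j\<le>k. \<Sum>l\<le>2 * j. ?c j l * ((\<Prod>i\<in>-I. fact (?a j l i)) * (fact (k - j) * fps_nth (square_series ^ card I) (k - j))))
    = fact k * fps_nth (square_series ^ Suc (card I)) k"
  proof -
    have "(\<Sum>l\<le>2 * j. real (2 * j choose l) * (-1) ^ (2 * j - l) * (\<Prod>i\<in>-I. fact (?a j l i))) = fact (2 * j)" for j
    proof -
      have "(\<Sum>l\<le>2 * j. real (2 * j choose l) * (-1) ^ (2 * j - l) * (\<Prod>i\<in>-I. fact (?a j l i)))
        = (\<Sum>l\<le>2 * j. fact (2 * j) * (-1) ^ l)"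
      proof (intro sum.cong refl)
        fix l assume "l \<in> {..2 * j}"
        then have l: "l \<le> 2 * j" by simp
        have "(\<Prod>i\<in>-I. fact (?a j l i)) = (fact l * fact (2 * j - l) :: real)"
          using I by simp
        moreover have "fact l * fact (2 * j - l) * real (2 * j choose l) = fact (2 * j)"
          using binomial_fact_lemma[OF l] by (metis of_nat_fact of_nat_mult)
        moreover have "(-1 :: real) ^ (2 * j - l) = (-1) ^ l"
          using l by (auto simp: minus_one_power_iff)
        ultimately show "real (2 * j choose l) * (-1) ^ (2 * j - l) * (\<Prod>i\<in>-I. fact (?a j l i)) = fact (2 * j) * (-1) ^ l"
          by (simp add: mult_ac)
      qed
      also have "\<dots> = fact (2 * j) * (\<Sum>l\<le>2 * j. (-1) ^ l)"
        by (simp add: sum_distrib_left)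
      \<comment> \<open>An odd number of alternating signs, beginning and ending with +1.\<close>
      also have "(\<Sum>l\<le>2 * j. (-1 :: real) ^ l) = 1"
        by (induction j) auto
      finally show ?thesis by simp
    qed
    moreover have "(\<Sum>l\<le>2 * j. ?c j l * ((\<Prod>i\<in>-I. fact (?a j l i)) * (fact (k - j) * fps_nth (square_series ^ card I) (k - j))))
      = real (k choose j) * (\<Sum>l\<le>2 * j. real (2 * j choose l) * (-1) ^ (2 * j - l) * (\<Prod>i\<in>-I. fact (?a j l i)))
          * (fact (k - j) * fps_nth (square_series ^ card I) (k - j))" for j
      by (simp only: sum_distrib_left sum_distrib_right mult.assoc)
    ultimately show ?thesis by (simp add: square_series_Suc mult.assoc del: power_Suc)
  qed
  finally show ?thesis .
qed

section \<open>Volumes in the orthant\<close>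

text \<open>Finiteness of \<open>X\<close> is part of the conclusion, so the product is multiplied
  by the inverse of \<open>F\<close> instead of being cancelled.\<close>

lemma ennreal_eq_divideI:
  assumes "X * ennreal F = ennreal y" "0 < F" "0 \<le> y"
  shows "X = ennreal (y / F)"
proof -
  have "X = X * (ennreal F * ennreal (1 / F))"
    using assms by (subst ennreal_mult[symmetric]) auto
  also have "\<dots> = ennreal y * ennreal (1 / F)"
    by (simp add: assms(1) mult.assoc[symmetric])
  also have "\<dots> = ennreal (y / F)"
    using assms by (subst ennreal_mult[symmetric]) auto
  finally show ?thesis .
qed

lemma orthant_scale: "0 < t \<Longrightarrow> x \<in> orthant \<Longrightarrow> t *\<^sub>R x \<in> orthant"
  by simp

lemma sum_scaleR_cart: "(\<Sum>i\<in>UNIV. (t *\<^sub>R x) $ i) = t * (\<Sum>i\<in>UNIV. x $ i)"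
  for x :: "real^'n::finite"
  by (simp add: sum_distrib_left)

lemma sum_pos_orthant: "x \<in> orthant \<Longrightarrow> 0 < (\<Sum>i\<in>UNIV. x $ i)"
  for x :: "real^'n::finite"
  by (auto intro: sum_pos)

lemma borel_measurable_sum_cart [measurable]:
  "(\<lambda>x::real^'n::finite. \<Sum>i\<in>UNIV. x $ i) \<in> borel_measurable borel"
  by (intro borel_measurable_continuous_onI continuous_intros)

text \<open>If \<open>D\<close> lists the moments of a random variable \<open>W\<close>, the result is the expectation of
  \<open>\<Sum>l. bs ! l * (W - c) ^ l\<close>; each step passes from the moments \<open>E ((W - c) ^ i * W ^ j)\<close> to those for \<open>i + 1\<close>.\<close>

fun central_sum :: "real \<Rightarrow> real list \<Rightarrow> real list \<Rightarrow> real" where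
  "central_sum c [] D = 0"
| "central_sum c (b # bs) D = b * hd D + central_sum c bs (map2 (\<lambda>y z. z - c * y) D (tl D))"

text \<open>Common ground of the two lattices: everything up to the integral bounds depends on the
  form only through its exponential moments \<open>m\<close>.\<close>

locale orthant_form =
  fixes U :: "real^'n::finite \<Rightarrow> real" and m :: "nat \<Rightarrow> real"
  assumes measurable_U [measurable]: "U \<in> borel_measurable borel"
    and U_scale: "U (t *\<^sub>R x) = t\<^sup>2 * U x"
    and U_bounds: "x \<in> orthant \<Longrightarrow> 0 \<le> U x \<and> U x \<le> (\<Sum>i\<in>UNIV. x $ i)\<^sup>2"
    and moments: "has_bochner_integral lborel (\<lambda>x. exp_weight x * U x ^ k) (m k)"
begin

abbreviation "s x \<equiv> \<Sum>i\<in>UNIV. x $ i"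

definition "W x = U x / (s x)\<^sup>2"

abbreviation "\<Delta> \<equiv> {x \<in> orthant. s x \<le> 1}"

lemma measurable_W [measurable]: "W \<in> borel_measurable borel"
  unfolding W_def[abs_def] by measurable

lemma sets_\<Delta> [measurable]: "\<Delta> \<in> sets borel"
proof -
  have "\<Delta> = orthant \<inter> {x \<in> space borel. s x \<le> 1}" by auto
  also have "\<dots> \<in> sets borel" by measurable
  finally show ?thesis .
qed

lemma W_scale: "0 < t \<Longrightarrow> W (t *\<^sub>R x) = W x"
  by (simp add: W_def U_scale sum_scaleR_cart power_mult_distrib del: vector_scaleR_component)

lemma W_bounds: "x \<in> orthant \<Longrightarrow> 0 \<le> W x \<and> W x \<le> 1"
  using U_bounds[of x] sum_pos_orthant[of x] by (simp add: W_def)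

lemma moment_nonneg: "0 \<le> m k"
  unfolding has_bochner_integral_integral_eq[OF moments[of k], symmetric]
  using U_bounds by (intro Bochner_Integration.integral_nonneg) (auto simp: indicator_def)

text \<open>Both gauges are taken to be \<open>s\<close>, so their ratio is 1, and the weight is
  r^(2k) exp(-r): the even power cancels the denominator of W^k, and the radial integral is a
  factorial.\<close>

lemma has_bochner_integral_W_power:
  "has_bochner_integral lborel (\<lambda>x. indicator \<Delta> x * W x ^ k)
     (m k / (CARD('n) * fact (2 * k + CARD('n) - 1)))"
proof (rule has_bochner_integral_nn_integral)
  let ?n = "CARD('n)"
  define \<psi> where "\<psi> r = ennreal (r ^ (2 * k) * exp (- r))" for r :: real
  have "(\<integral>\<^sup>+r. \<psi> r * ennreal (r ^ (?n - 1)) * indicator {0<..} r \<partial>lborel)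
     = (\<integral>\<^sup>+r. ennreal (indicator {0<..} r * (r ^ (2 * k + ?n - 1) * exp (- r))) \<partial>lborel)"
  proof (intro nn_integral_cong)
    fix r :: real
    have "r ^ (2 * k + ?n - 1) = r ^ (2 * k) * r ^ (?n - 1)"
      by (simp add: power_add[symmetric])
    then show "\<psi> r * ennreal (r ^ (?n - 1)) * indicator {0<..} r
       = ennreal (indicator {0<..} r * (r ^ (2 * k + ?n - 1) * exp (- r)))"
      by (auto simp: \<psi>_def indicator_def ennreal_mult[symmetric] mult_ac)
  qed
  also have "\<dots> = ennreal (fact (2 * k + ?n - 1))"
    by (rule nn_integral_power_times_exp)
  finally have psi: "(\<integral>\<^sup>+r. \<psi> r * ennreal (r ^ (?n - 1)) * indicator {0<..} r \<partial>lborel)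
     = ennreal (fact (2 * k + ?n - 1))" .
  have "(\<integral>\<^sup>+x. ennreal (W x ^ k) * indicator orthant x * indicator {..1} (s x) \<partial>lborel) *
      (\<integral>\<^sup>+r. \<psi> r * ennreal (r ^ (DIM(real^'n) - 1)) * indicator {0<..} r \<partial>lborel)
    = (\<integral>\<^sup>+x. ennreal (W x ^ k) * indicator orthant x * (ennreal ((s x / s x) ^ DIM(real^'n) / DIM(real^'n)) * \<psi> (s x)) \<partial>lborel)"
  proof (rule nn_integral_homogeneous)
    show "t *\<^sub>R x \<in> orthant" if "0 < t" "x \<in> orthant" for t and x :: "real^'n"
      using that by (rule orthant_scale)
  qed (auto simp: \<psi>_def W_scale sum_pos_orthant sum_scaleR_cart simp del: vector_scaleR_component)
  also have "\<dots> = (\<integral>\<^sup>+x. ennreal (1 / ?n * (exp_weight x * U x ^ k)) \<partial>lborel)"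
  proof (intro nn_integral_cong)
    fix x :: "real^'n"
    show "ennreal (W x ^ k) * indicator orthant x * (ennreal ((s x / s x) ^ DIM(real^'n) / DIM(real^'n)) * \<psi> (s x))
        = ennreal (1 / ?n * (exp_weight x * U x ^ k))"
    proof (cases "x \<in> orthant")
      case True
      have "s x > 0" by (rule sum_pos_orthant[OF True])
      moreover have "W x ^ k * s x ^ (2 * k) = U x ^ k"
        using \<open>s x > 0\<close> by (simp add: W_def power_divide power_mult)
      ultimately show ?thesis
        using True W_bounds[OF True] U_bounds[OF True]
        by (simp add: \<psi>_def ennreal_mult[symmetric] mult_ac)
    qed simp
  qed
  also have "\<dots> = ennreal (1 / ?n * m k)"
    using has_bochner_integral_mult_right[OF moments[of k], of "1 / ?n"] U_bounds
    by (subst nn_integral_eq_integral) (auto simp: has_bochner_integral_iff indicator_def)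
  finally have "(\<integral>\<^sup>+x. ennreal (W x ^ k) * indicator orthant x * indicator {..1} (s x) \<partial>lborel) = ennreal (1 / ?n * m k / fact (2 * k + ?n - 1))"
    using moment_nonneg[of k] psi by (intro ennreal_eq_divideI) auto
  also have "(\<integral>\<^sup>+x. ennreal (W x ^ k) * indicator orthant x * indicator {..1} (s x) \<partial>lborel)
     = (\<integral>\<^sup>+x. ennreal (indicator \<Delta> x * W x ^ k) \<partial>lborel)"
    by (intro nn_integral_cong) (auto simp: indicator_def)
  finally show "(\<integral>\<^sup>+x. ennreal (indicator \<Delta> x * W x ^ k) \<partial>lborel) = ennreal (m k / (?n * fact (2 * k + ?n - 1)))"
    by (simp add: field_simps)
  show "AE x in lborel. 0 \<le> indicator \<Delta> x * W x ^ k"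
    using W_bounds by (intro AE_I2) (auto simp: indicator_def)
qed (use moment_nonneg in auto)

lemma integrable_powr:
  assumes "a > 0"
  shows "integrable lborel (\<lambda>x. indicator \<Delta> x * (1 + W x) powr (- a))"
proof (rule Bochner_Integration.integrable_bound)
  show "integrable lborel (\<lambda>x. indicator \<Delta> x * W x ^ 0)"
    using has_bochner_integral_W_power[of 0] by (rule integrable.intros)
  have "(1 + W x) powr (- a) \<le> 1" if "x \<in> orthant" for x
    using W_bounds[OF that] assms powr_mono[of "- a" 0 "1 + W x"] by simp
  then show "AE x in lborel. norm (indicator \<Delta> x * (1 + W x) powr (- a)) \<le> norm (indicator \<Delta> x * W x ^ 0)"
    by (intro AE_I2) (auto simp: indicator_def)
qed measurable

text \<open>Here the gauge \<open>N\<close> is the root of the form and the weight is the indicator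
  of r \<le> 1, so the region bounded by the form is traded for the simplex. The radial integral 1/n
  cancels the dimension.\<close>

lemma measure_orthant_le_1:
  "measure lebesgue {x. (\<forall>i. 0 < x $ i) \<and> ((s x)\<^sup>2 + U x) / 2 \<le> 1}
    = 2 powr (CARD('n) / 2) * (LINT x|lborel. indicator \<Delta> x * (1 + W x) powr (- (CARD('n) / 2)))"
  (is "measure lebesgue ?V = ?c * ?I")
proof -
  let ?n = "CARD('n)"
  define N where "N x = sqrt (((s x)\<^sup>2 + U x) / 2)" for x
  have [measurable]: "N \<in> borel_measurable borel"
    unfolding N_def[abs_def] by measurable
  have V: "?V = orthant \<inter> {x \<in> space borel. ((s x)\<^sup>2 + U x) / 2 \<le> 1}"
    by auto
  have V_sets [measurable]: "?V \<in> sets borel"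
    unfolding V by measurable
  have N_pos: "0 < N x" if "x \<in> orthant" for x
    using sum_pos_orthant[OF that] U_bounds[OF that] by (simp add: N_def add_pos_nonneg)
  have N_scale: "N (t *\<^sub>R x) = t * N x" if "0 < t" for t x
  proof -
    have "N (t *\<^sub>R x) = sqrt (t\<^sup>2 * (((s x)\<^sup>2 + U x) / 2))"
      by (simp add: N_def U_scale sum_scaleR_cart power_mult_distrib algebra_simps del: vector_scaleR_component)
    also have "\<dots> = t * N x"
      using that by (simp only: real_sqrt_mult N_def) simp
    finally show ?thesis .
  qed
  have ratio: "(s x / N x) ^ ?n = ?c * (1 + W x) powr (- (?n / 2))" if "x \<in> orthant" for x
  proof -
    have s: "0 < s x" by (rule sum_pos_orthant[OF that])
    have W: "0 < 1 + W x" using W_bounds[OF that] by simp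
    have "((s x)\<^sup>2 + U x) / 2 = (s x)\<^sup>2 * ((1 + W x) / 2)"
      using s by (simp add: W_def field_simps)
    then have "N x = s x * sqrt ((1 + W x) / 2)"
      using s by (simp only: N_def real_sqrt_mult) simp
    then have "s x / N x = sqrt (2 / (1 + W x))"
      using s W by (simp add: real_sqrt_divide)
    also have "\<dots> = (2 / (1 + W x)) powr (1 / 2)"
      using W by (simp add: powr_half_sqrt)
    finally have "(s x / N x) ^ ?n = (2 / (1 + W x)) powr (?n / 2)"
      using W by (simp add: powr_power)
    then show ?thesis
      using W by (simp add: powr_divide powr_minus field_simps)
  qed
  define \<psi> where "\<psi> r = (indicator {..1} r :: ennreal)" for r :: real
  have "(\<integral>\<^sup>+r. \<psi> r * ennreal (r ^ (?n - 1)) * indicator {0<..} r \<partial>lborel)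
     = (\<integral>\<^sup>+r. ennreal (r ^ (?n - 1)) * indicator {0..1} r \<partial>lborel)"
    by (intro nn_integral_cong_AE eventually_mono[OF AE_lborel_singleton[of 0]])
       (auto simp: indicator_def \<psi>_def)
  also have "\<dots> = ennreal (1 ^ ?n / ?n - 0 ^ ?n / ?n)"
  proof (rule nn_integral_FTC_Icc[where F = "\<lambda>r. r ^ ?n / ?n"])
    show "((\<lambda>r. r ^ ?n / ?n) has_real_derivative r ^ (?n - 1)) (at r)" for r :: real
      by (auto intro!: derivative_eq_intros)
  qed auto
  finally have psi: "(\<integral>\<^sup>+r. \<psi> r * ennreal (r ^ (?n - 1)) * indicator {0<..} r \<partial>lborel) = ennreal (1 / ?n)"
    by (simp add: power_0_left)
  have "(\<integral>\<^sup>+x. 1 * indicator orthant x * indicator {..1} (N x) \<partial>lborel) *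
      (\<integral>\<^sup>+r. \<psi> r * ennreal (r ^ (DIM(real^'n) - 1)) * indicator {0<..} r \<partial>lborel)
    = (\<integral>\<^sup>+x. 1 * indicator orthant x * (ennreal ((s x / N x) ^ DIM(real^'n) / DIM(real^'n)) * \<psi> (s x)) \<partial>lborel)"
  proof (rule nn_integral_homogeneous)
    show "t *\<^sub>R x \<in> orthant" if "0 < t" "x \<in> orthant" for t and x :: "real^'n"
      using that by (rule orthant_scale)
  qed (auto simp: \<psi>_def N_pos N_scale sum_pos_orthant sum_scaleR_cart simp del: vector_scaleR_component)
  also have "\<dots> = (\<integral>\<^sup>+x. ennreal (?c / ?n * (indicator \<Delta> x * (1 + W x) powr (- (?n / 2)))) \<partial>lborel)"
    using ratio by (intro nn_integral_cong) (auto simp: \<psi>_def indicator_def)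
  also have "\<dots> = ennreal (?c / ?n * ?I)"
    using integrable_powr[of "?n / 2"]
    by (subst nn_integral_eq_integral) (auto simp: indicator_def)
  finally have *: "(\<integral>\<^sup>+x. 1 * indicator orthant x * indicator {..1} (N x) \<partial>lborel) = ennreal (?c / ?n * ?I / (1 / ?n))"
    using psi by (intro ennreal_eq_divideI) (auto intro!: mult_nonneg_nonneg integral_nonneg)
  have "emeasure lborel ?V = (\<integral>\<^sup>+x. indicator ?V x \<partial>lborel)"
    by simp
  also have "\<dots> = (\<integral>\<^sup>+x. 1 * indicator orthant x * indicator {..1} (N x) \<partial>lborel)"
    by (intro nn_integral_cong) (auto simp: indicator_def N_def)
  also have "\<dots> = ennreal (?c * ?I)"
    using * by simp
  finally have "measure lborel ?V = ?c * ?I"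
    by (simp add: measure_def integral_nonneg)
  moreover have "measure lebesgue ?V = measure lborel ?V"
    by (rule measure_completion) simp
  ultimately show ?thesis by simp
qed

text \<open>The exponent \<open>i\<close> is general because the recursion raises it: one more
  factor W - c is the next moment minus \<open>c\<close> times the current one. Each step shortens
  \<open>D\<close> by one entry, whence the length condition.\<close>

lemma has_bochner_integral_W_central:
  assumes "\<And>j. j < length D \<Longrightarrow> has_bochner_integral lborel (\<lambda>x. indicator \<Delta> x * ((W x - c) ^ i * W x ^ j)) (D ! j)"
    and "length bs \<le> length D"
  shows "has_bochner_integral lborel
    (\<lambda>x. indicator \<Delta> x * (\<Sum>l<length bs. bs ! l * (W x - c) ^ (i + l))) (central_sum c bs D)"
  using assms
proof (induction bs arbitrary: i D)
  case Nil
  show ?case by (simp add: has_bochner_integral_zero)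
next
  case (Cons b bs)
  let ?D = "map2 (\<lambda>y z. z - c * y) D (tl D)"
  have "has_bochner_integral lborel (\<lambda>x. indicator \<Delta> x * ((W x - c) ^ Suc i * W x ^ j)) (?D ! j)"
    if j: "j < length ?D" for j
  proof -
    have "has_bochner_integral lborel
      (\<lambda>x. indicator \<Delta> x * ((W x - c) ^ i * W x ^ Suc j) - c * (indicator \<Delta> x * ((W x - c) ^ i * W x ^ j)))
      (D ! Suc j - c * D ! j)"
      using j by (intro has_bochner_integral_diff has_bochner_integral_mult_right Cons.prems(1)) auto
    then show ?thesis
      using j by (simp add: nth_tl algebra_simps)
  qed
  then have "has_bochner_integral lborel
      (\<lambda>x. indicator \<Delta> x * (\<Sum>l<length bs. bs ! l * (W x - c) ^ (Suc i + l))) (central_sum c bs ?D)"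
    using Cons.prems(2) by (intro Cons.IH) auto
  moreover have "has_bochner_integral lborel (\<lambda>x. b * (indicator \<Delta> x * ((W x - c) ^ i * W x ^ 0))) (b * D ! 0)"
    using Cons.prems(2) by (intro has_bochner_integral_mult_right Cons.prems(1)) auto
  ultimately have "has_bochner_integral lborel
      (\<lambda>x. b * (indicator \<Delta> x * ((W x - c) ^ i * W x ^ 0)) + indicator \<Delta> x * (\<Sum>l<length bs. bs ! l * (W x - c) ^ (Suc i + l)))
      (b * D ! 0 + central_sum c bs ?D)"
    by (intro has_bochner_integral_add)
  moreover have "hd D = D ! 0"
    using Cons.prems(2) by (intro hd_conv_nth) auto
  ultimately show ?case
    unfolding length_Cons sum.lessThan_Suc_shift
    by (simp add: algebra_simps del: sum.lessThan_Suc)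
qed

text \<open>The coefficient appended for the upper bound carries no power of 1 + c, since it
  majorizes the remainder rather than continuing the expansion.\<close>

lemma powr_integral_bounds:
  assumes a: "a > 0" and c: "c \<ge> 0" and n: "even n" "n > 0" "n < N"
  defines "D \<equiv> map (\<lambda>j. m j / (CARD('n) * fact (2 * j + CARD('n) - 1))) [0..<N]"
    and "bs \<equiv> map (\<lambda>j. ((- a) gchoose j) * (1 + c) powr (- a - real j)) [0..<n]"
  shows "central_sum c bs D \<le> (LINT x|lborel. indicator \<Delta> x * (1 + W x) powr (- a))"
    and "(LINT x|lborel. indicator \<Delta> x * (1 + W x) powr (- a)) \<le> central_sum c (bs @ [(- a) gchoose n]) D"
proof -
  have D: "has_bochner_integral lborel (\<lambda>x. indicator \<Delta> x * ((W x - c) ^ 0 * W x ^ j)) (D ! j)"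
    if "j < length D" for j
    using that has_bochner_integral_W_power[of j] by (simp add: D_def nth_append)
  have bs: "has_bochner_integral lborel (\<lambda>x. indicator \<Delta> x * (\<Sum>l<length bs. bs ! l * (W x - c) ^ (0 + l))) (central_sum c bs D)"
    by (rule has_bochner_integral_W_central[OF D]) (use n in \<open>simp_all add: D_def bs_def\<close>)
  have bs': "has_bochner_integral lborel (\<lambda>x. indicator \<Delta> x * (\<Sum>l<length (bs @ [(- a) gchoose n]). (bs @ [(- a) gchoose n]) ! l * (W x - c) ^ (0 + l)))
      (central_sum c (bs @ [(- a) gchoose n]) D)"
    by (rule has_bochner_integral_W_central[OF D]) (use n in \<open>simp_all add: D_def bs_def\<close>)
  have eq: "(\<Sum>l<length bs. bs ! l * (W x - c) ^ (0 + l)) = (\<Sum>l<n. ((- a) gchoose l) * (1 + c) powr (- a - real l) * (W x - c) ^ l)" for x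
    by (auto simp: bs_def intro!: sum.cong)
  have eq': "(\<Sum>l<length (bs @ [(- a) gchoose n]). (bs @ [(- a) gchoose n]) ! l * (W x - c) ^ (0 + l))
    = (\<Sum>l<n. ((- a) gchoose l) * (1 + c) powr (- a - real l) * (W x - c) ^ l) + ((- a) gchoose n) * (W x - c) ^ n" for x
    by (auto simp: bs_def nth_append intro!: sum.cong)
  note taylor = powr_taylor_bounds[OF a n(1,2) c]
  show "central_sum c bs D \<le> (LINT x|lborel. indicator \<Delta> x * (1 + W x) powr (- a))"
    unfolding has_bochner_integral_integral_eq[OF bs, symmetric] unfolding eq
    using integrable.intros[OF bs] integrable_powr[OF a] taylor(1) W_bounds unfolding eq
    by (intro integral_mono) (auto simp: indicator_def)
  show "(LINT x|lborel. indicator \<Delta> x * (1 + W x) powr (- a)) \<le> central_sum c (bs @ [(- a) gchoose n]) D"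
    unfolding has_bochner_integral_integral_eq[OF bs', symmetric] unfolding eq'
    using integrable.intros[OF bs'] integrable_powr[OF a] taylor(2) W_bounds unfolding eq'
    by (intro integral_mono) (auto simp: indicator_def)
qed

end

section \<open>Numerical evaluation\<close>

lemma fps_nth_mult_list:
  fixes f g :: "'a::comm_semiring_1 fps"
  shows "fps_nth (f * g) k = sum_list (map2 (*) (map (fps_nth f) [0..<Suc k]) (rev (map (fps_nth g) [0..<Suc k])))"
proof -
  have "map2 (*) (map (fps_nth f) [0..<Suc k]) (rev (map (fps_nth g) [0..<Suc k]))
      = map (\<lambda>i. fps_nth f i * fps_nth g (k - i)) [0..<Suc k]"
    by (rule nth_equalityI) (auto simp: rev_nth simp del: upt_Suc)
  then show ?thesis
    by (simp add: fps_mult_nth interv_sum_list_conv_sum_set_nat atLeast0AtMost atLeast0LessThan lessThan_Suc_atMost del: upt_Suc)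
qed

text \<open>The second argument holds the coefficients of the second factor already consumed, in
  reverse order, so that zipping with \<open>xs\<close> pairs indices of constant sum.\<close>

fun convolve :: "'a::comm_semiring_1 list \<Rightarrow> 'a list \<Rightarrow> 'a list \<Rightarrow> 'a list" where
  "convolve xs ys [] = []"
| "convolve xs ys (z # zs) = sum_list (map2 (*) xs (z # ys)) # convolve xs (z # ys) zs"

lemma convolve_eq:
  fixes f g :: "'a::comm_semiring_1 fps"
  assumes "l + k \<le> n"
  shows "convolve (map (fps_nth f) [0..<n]) (rev (map (fps_nth g) [0..<k])) (map (fps_nth g) [k..<k + l])
    = map (fps_nth (f * g)) [k..<k + l]"
  using assms
proof (induction l arbitrary: k)
  case 0
  then show ?case by simp
next
  case (Suc l)
  have upt: "[k..<k + Suc l] = k # [Suc k..<Suc k + l]"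
    by (subst upt_conv_Cons) auto
  have rev: "fps_nth g k # rev (map (fps_nth g) [0..<k]) = rev (map (fps_nth g) [0..<Suc k])"
    by simp
  \<comment> \<open>Zipping stops at the shorter list, so the surplus coefficients of
    \<open>f\<close> drop out.\<close>
  have take: "map2 (*) (map (fps_nth f) [0..<n]) (rev (map (fps_nth g) [0..<Suc k]))
    = map2 (*) (map (fps_nth f) [0..<Suc k]) (rev (map (fps_nth g) [0..<Suc k]))"
    using Suc.prems by (intro nth_equalityI) (auto simp del: upt_Suc)
  show ?case
    unfolding upt list.map convolve.simps rev take fps_nth_mult_list[symmetric]
    using Suc.prems by (subst Suc.IH) auto
qed

lemma map_fps_nth_mult:
  fixes f g :: "'a::comm_semiring_1 fps"
  shows "map (fps_nth (f * g)) [0..<n] = convolve (map (fps_nth f) [0..<n]) [] (map (fps_nth g) [0..<n])"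
  using convolve_eq[of n 0 n f g] by simp

text \<open>Passes from each term to the next by the ratio of consecutive binomial terms, so that
  evaluation needs only rational arithmetic.\<close>

fun binomial_terms :: "real \<Rightarrow> real \<Rightarrow> real \<Rightarrow> real list \<Rightarrow> real list" where
  "binomial_terms b r x [] = []"
| "binomial_terms b r x (k # ks) = x # binomial_terms b r (x * ((b - k) / (k + 1) * r)) ks"

lemma gbinomial_Suc_divide: "(b gchoose Suc k) = (b gchoose k) * (b - real k) / (real k + 1)" for b :: real
proof -
  have "(real k + 1) * (b gchoose Suc k) = (b gchoose k) * (b - real k)"
    using gbinomial_mult_1[of b k] by (simp add: algebra_simps)
  then show ?thesis by (simp add: field_simps)
qed

lemma binomial_terms_eq:
  "map (\<lambda>j. (b gchoose j) * (x * r ^ j)) [k..<k + n]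
    = binomial_terms b r ((b gchoose k) * (x * r ^ k)) (map real [k..<k + n])"
proof (induction n arbitrary: k)
  case (Suc n)
  have upt: "[k..<k + Suc n] = k # [Suc k..<Suc k + n]"
    by (subst upt_conv_Cons) auto
  show ?case
    unfolding upt list.map Suc.IH by (simp add: gbinomial_Suc_divide add.commute mult_ac)
qed simp

lemma gbinomial_prod_list: "(b gchoose n) = prod_list (map (\<lambda>i. (b - real i) / (real i + 1)) [0..<n])" for b :: real
  by (induction n) (auto simp: gbinomial_Suc_divide)

text \<open>The centre \<open>11/25\<close> lies near the bulk of the values of \<open>U/s\<^sup>2\<close> and makes \<open>1 + 11/25 = (6/5)\<^sup>2\<close> a
  rational square, so that all Taylor coefficients are rational.\<close>

lemma powr_coefficients:
  "map (\<lambda>j. ((- (5/2)) gchoose j) * (1 + 11/25) powr (- (5/2) - real j)) [0..<n]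
    = binomial_terms (- (5/2)) (25/36) (3125/7776) (map real [0..<n])"
proof -
  have "(36 / 25 :: real) powr (- (5/2) - real j) = 3125/7776 * (25/36) ^ j" for j
  proof -
    have sq: "(36 / 25 :: real) = (6/5) powr 2"
      by (simp add: power2_eq_square)
    then have "(36 / 25 :: real) powr (- (5/2) - real j) = ((6/5) powr 2) powr (- (5/2) - real j)"
      by (simp only: sq)
    also have "\<dots> = (6/5) powr - (real (5 + 2 * j))"
      unfolding powr_powr by (rule arg_cong[where f = "\<lambda>y. (6/5) powr y"]) simp
    also have "\<dots> = inverse ((6/5) ^ (5 + 2 * j))"
      by (simp only: powr_minus powr_realpow[of "6/5"])
    also have "\<dots> = 3125/7776 * (25/36) ^ j"
      by (simp add: power_add power_mult power_inverse[symmetric] power2_eq_square power_divide)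
    finally show ?thesis .
  qed
  moreover have "(1 + 11/25 :: real) = 36/25"
    by simp
  ultimately show ?thesis
    using binomial_terms_eq[of "- (5/2)" "3125/7776" "25/36" 0 n] by (simp only:) simp
qed

lemma upt_numeral:
  "[0..<numeral k] = (if 1 < (numeral k :: nat) then 0 # 1 # [2..<numeral k] else [0])"
  by (simp add: upt_rec numeral_2_eq_2)

section \<open>Tables of moments and rational bounds\<close>

lemma square_series_coeffs:
  "map (fps_nth square_series) [0..<21] =
    [1, 2, 12, 120, 1680, 30240, 665280, 17297280, 518918400, 17643225600, 670442572800,
     28158588057600, 1295295050649600, 64764752532480000, 3497296636753920000,
     202843204931727360000, 12576278705767096320000, 830034394580628357120000,
     58102407620643984998400000, 4299578163927654889881600000,
     335367096786357081410764800000]"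
  by (simp add: upt_numeral square_series_def fact_numeral)

lemma square_series_power2_coeffs:
  "map (fps_nth (square_series ^ 2)) [0..<21] =
    [1, 4, 28, 288, 3984, 70080, 1506240, 38384640, 1133072640, 38038533120, 1431213235200,
     59645279232000, 2726781752217600, 135661078090137600, 7295806823277772800,
     421717409630060544000, 26071235813929033728000, 1716456412254215503872000,
     119894838461795743137792000, 8855582025475893129117696000,
     689590377805392806575472640000]"
  unfolding power2_eq_square map_fps_nth_mult square_series_coeffs by simp

lemma square_series_power4_coeffs:
  "map (fps_nth (square_series ^ 4)) [0..<21] =
    [1, 8, 72, 800, 11056, 188160, 3879168, 95038464, 2713810176, 88717178880, 3269209282560,
     134040035450880, 6049460947415040, 297878460111912960, 15885579857353113600,
     911846348431648358400, 56041519292975023718400, 3671140158152629302067200,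
     255318857468379645463756800, 18786706230893957945229312000,
     1458040203549219901074702336000]"
proof -
  have "square_series ^ 4 = square_series ^ 2 * square_series ^ 2"
    by (simp flip: power_add)
  then show ?thesis
    by (simp only: map_fps_nth_mult square_series_power2_coeffs) simp
qed

lemma square_series_power5_coeffs:
  "map (fps_nth (square_series ^ 5)) [0..<21] =
    [1, 10, 100, 1160, 16160, 272192, 5512320, 132522240, 3720979200, 119973404160,
     4372964600832, 177769681459200, 7969373507174400, 390323192795136000,
     20725587448012800000, 1185424102745417318400, 72637456731410866176000,
     4746174517777510121472000, 329359179945708803358720000,
     24188196782003582320312320000, 1874077188199681516984074240000]"
proof -
  have "square_series ^ 5 = square_series * square_series ^ 4"
    by (simp flip: power_Suc)
  then show ?thesis
    by (simp only: map_fps_nth_mult square_series_coeffs square_series_power4_coeffs) simp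
qed

text \<open>Zipping cuts the table to its first \<open>n\<close> entries, so 21 tabulated
  coefficients serve every expansion up to degree 20.\<close>

definition moment_list :: "nat \<Rightarrow> real list \<Rightarrow> real list" where
  "moment_list n xs = map2 (*) (map (\<lambda>j. fact j / (5 * fact (2 * j + 4))) [0..<n]) xs"

lemma moment_list_eq:
  assumes "n \<le> 21"
  shows "map (\<lambda>j. fact j * fps_nth f j / (CARD(5) * fact (2 * j + CARD(5) - 1))) [0..<n]
    = moment_list n (map (fps_nth f) [0..<21])"
  using assms by (intro nth_equalityI) (auto simp: moment_list_def add.commute[of 4 "2 * i" for i :: nat])

text \<open>The decimals here and in the upper bound are chosen so that multiplication by 5 sqrt 6,
  about 12.25, stays within 5e-8 of 0.0505862.\<close>

lemma R_A5_lower_bound: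
  "0.0041303425 \<le> central_sum (11/25) (binomial_terms (- (5/2)) (25/36) (3125/7776) (map real [0..<12]))
    (moment_list 13 (map (fps_nth (square_series ^ 5)) [0..<21]))"
  unfolding square_series_power5_coeffs moment_list_def
  by (simp add: upt_numeral fact_numeral)

lemma R_A5_upper_bound:
  "central_sum (11/25) (binomial_terms (- (5/2)) (25/36) (3125/7776) (map real [0..<14]) @ [(- (5/2)) gchoose 14])
    (moment_list 15 (map (fps_nth (square_series ^ 5)) [0..<21])) \<le> 0.0041303450"
  unfolding square_series_power5_coeffs moment_list_def gbinomial_prod_list
  by (simp add: upt_numeral fact_numeral)

lemma R_0_lower_bound:
  "0.00479361 \<le> central_sum (11/25) (binomial_terms (- (5/2)) (25/36) (3125/7776) (map real [0..<12]))
    (moment_list 13 (map (fps_nth (square_series ^ 4)) [0..<21]))"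
  unfolding square_series_power4_coeffs moment_list_def
  by (simp add: upt_numeral fact_numeral)

lemma R_0_upper_bound:
  "central_sum (11/25) (binomial_terms (- (5/2)) (25/36) (3125/7776) (map real [0..<20]) @ [(- (5/2)) gchoose 20])
    (moment_list 21 (map (fps_nth (square_series ^ 4)) [0..<21])) \<le> 0.0047936145"
  unfolding square_series_power4_coeffs moment_list_def gbinomial_prod_list
  by (simp add: upt_numeral fact_numeral)

section \<open>The two lattices\<close>

lemma det_gram_lower_triangular:
  fixes v :: "'n::{finite,wellorder} \<Rightarrow> real^('n::{finite,wellorder})"
  assumes "\<And>i j. i < j \<Longrightarrow> v i $ j = 0"
  shows "det (gram v) = (\<Prod>i\<in>UNIV. (v i $ i)\<^sup>2)"
proof -
  define M where "M = (\<chi> i. v i)"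
  have "gram v = M ** transpose M"
    by (simp add: gram_def M_def vec_eq_iff matrix_matrix_mult_def transpose_def inner_vec_def)
  moreover have "det M = (\<Prod>i\<in>UNIV. v i $ i)"
    using assms by (subst det_lowerdiagonal) (auto simp: M_def)
  ultimately show ?thesis
    by (simp add: det_mul det_transpose power2_eq_square prod.distrib)
qed

lemma prod_5: "prod f (UNIV :: 5 set) = f 0 * f 1 * f 2 * f 3 * f 4"
  unfolding UNIV_5 by (simp add: mult.assoc)

lemma less_5: "(0::5) < 1" "(0::5) < 2" "(0::5) < 3" "(0::5) < 4" "(1::5) < 2" "(1::5) < 3"
  "(1::5) < 4" "(2::5) < 3" "(2::5) < 4" "(3::5) < 4"
  by (simp_all add: less_bit1_def bit1.Rep_0 bit1.Rep_1 bit1.Rep_numeral)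

text \<open>The rows of the lower triangular Cholesky factors of the two Gram matrices.\<close>

definition basis_A5 :: "5 \<Rightarrow> real^5" where
  "basis_A5 i = (\<chi> k. let r = sqrt (if k = 0 then 1/4 else if k = 1 then 1/12 else
      if k = 2 then 1/24 else if k = 3 then 1/40 else 1/60);
      d = (if k = 0 then 2 else if k = 1 then 3 else if k = 2 then 4 else if k = 3 then 5 else 6)
    in if k < i then r else if k = i then d * r else 0)"

definition basis_0 :: "5 \<Rightarrow> real^5" where
  "basis_0 i = (\<chi> k. if k = i then (if k = 0 \<or> k = 1 then 1 else sqrt (1/2))
     else if k < i \<and> (k = 0 \<or> k = 1) \<and> i \<noteq> 1 then 1/2 else 0)"

lemma basis_A5_nth:
  "basis_A5 i $ 0 = (if i = 0 then 2 else 1) * sqrt (1/4)"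
  "basis_A5 i $ 1 = (if i = 0 then 0 else if i = 1 then 3 else 1) * sqrt (1/12)"
  "basis_A5 i $ 2 = (if i = 0 \<or> i = 1 then 0 else if i = 2 then 4 else 1) * sqrt (1/24)"
  "basis_A5 i $ 3 = (if i = 0 \<or> i = 1 \<or> i = 2 then 0 else if i = 3 then 5 else 1) * sqrt (1/40)"
  "basis_A5 i $ 4 = (if i = 4 then 6 else 0) * sqrt (1/60)"
  using exhaust_5[of i]
  by (elim disjE; simp add: basis_A5_def less_5 less_5[THEN less_not_sym])+

lemma basis_0_nth:
  "basis_0 i $ 0 = (if i = 0 then 1 else if i = 1 then 0 else 1/2)"
  "basis_0 i $ 1 = (if i = 0 then 0 else if i = 1 then 1 else 1/2)"
  "basis_0 i $ 2 = (if i = 2 then 1 else 0) * sqrt (1/2)"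
  "basis_0 i $ 3 = (if i = 3 then 1 else 0) * sqrt (1/2)"
  "basis_0 i $ 4 = (if i = 4 then 1 else 0) * sqrt (1/2)"
  using exhaust_5[of i]
  by (elim disjE; simp add: basis_0_def less_5 less_5[THEN less_not_sym])+

text \<open>With indices from 0, the squared scale of column k is 1/(2(k+1)(k+2)). These telescope:
  the first i of them add up to i/(2(i+1)), which leaves (i+2)/(2(i+1)) for the square of the
  diagonal entry.\<close>

lemma gram_basis_A5: "gram basis_A5 = R_A5"
proof -
  have sqrt_sq: "(a * sqrt (1 / numeral w)) * (b * sqrt (1 / numeral w)) = a * b * (1 / numeral w)" for a b :: real and w
    by (simp add: mult.commute mult.left_commute)
  have "basis_A5 i \<bullet> basis_A5 j = R_A5 $ i $ j" for i j
  proof -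
    have "basis_A5 i \<bullet> basis_A5 j = (\<Sum>k\<in>UNIV. basis_A5 i $ k * basis_A5 j $ k)"
      by (simp add: inner_vec_def)
    also have "\<dots> = R_A5 $ i $ j"
      unfolding sum_5 basis_A5_nth sqrt_sq using exhaust_5[of i] exhaust_5[of j]
      by (elim disjE) (simp_all add: R_A5_def)
    finally show ?thesis .
  qed
  then show ?thesis
    by (simp add: gram_def vec_eq_iff)
qed

text \<open>The first two vectors are orthonormal. The other three share the projection (1/2, 1/2)
  onto their plane, which produces every inner product 1/2, and each has a coordinate of its own for
  the missing half of its squared length.\<close>

lemma gram_basis_0: "gram basis_0 = R_0"
proof -
  have sqrt_sq: "(a * sqrt (1 / numeral w)) * (b * sqrt (1 / numeral w)) = a * b * (1 / numeral w)" for a b :: real and w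
    by (simp add: mult.commute mult.left_commute)
  have "basis_0 i \<bullet> basis_0 j = R_0 $ i $ j" for i j
  proof -
    have "basis_0 i \<bullet> basis_0 j = (\<Sum>k\<in>UNIV. basis_0 i $ k * basis_0 j $ k)"
      by (simp add: inner_vec_def)
    also have "\<dots> = R_0 $ i $ j"
      unfolding sum_5 basis_0_nth sqrt_sq using exhaust_5[of i] exhaust_5[of j]
      by (elim disjE) (simp_all add: R_0_def R_A5_def)
    finally show ?thesis .
  qed
  then show ?thesis
    by (simp add: gram_def vec_eq_iff)
qed

lemma det_R_A5: "det R_A5 = 3/16"
proof -
  have "basis_A5 i $ j = 0" if "i < j" for i j
    using that less_not_sym[OF that] less_imp_neq[OF that] by (simp add: basis_A5_def)
  then have "det (gram basis_A5) = (\<Prod>i\<in>UNIV. (basis_A5 i $ i)\<^sup>2)"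
    by (rule det_gram_lower_triangular)
  then show ?thesis
    unfolding gram_basis_A5 prod_5 basis_A5_nth by (simp add: power_mult_distrib)
qed

lemma det_R_0: "det R_0 = 1/8"
proof -
  have "basis_0 i $ j = 0" if "i < j" for i j
    using that less_not_sym[OF that] less_imp_neq[OF that] by (simp add: basis_0_def)
  then have "det (gram basis_0) = (\<Prod>i\<in>UNIV. (basis_0 i $ i)\<^sup>2)"
    by (rule det_gram_lower_triangular)
  then show ?thesis
    unfolding gram_basis_0 prod_5 basis_0_nth by (simp add: power_mult_distrib)
qed

section \<open>Moment data of the two forms\<close>

interpretation A5: orthant_form "\<lambda>x::real^5. \<Sum>i\<in>UNIV. (x $ i)\<^sup>2" "\<lambda>k. fact k * fps_nth (square_series ^ 5) k"
proof
  show "(\<lambda>x::real^5. \<Sum>i\<in>UNIV. (x $ i)\<^sup>2) \<in> borel_measurable borel"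
    by (intro borel_measurable_continuous_onI continuous_intros)
  show "(\<Sum>i\<in>UNIV. ((t *\<^sub>R x) $ i)\<^sup>2) = t\<^sup>2 * (\<Sum>i\<in>UNIV. (x $ i)\<^sup>2)" for t and x :: "real^5"
    by (simp add: power_mult_distrib sum_distrib_left)
  show "0 \<le> (\<Sum>i\<in>UNIV. (x $ i)\<^sup>2) \<and> (\<Sum>i\<in>UNIV. (x $ i)\<^sup>2) \<le> (\<Sum>i\<in>UNIV. x $ i)\<^sup>2"
    if "x \<in> orthant" for x :: "real^5"
  proof
    have "(\<Sum>i\<in>UNIV. (x $ i)\<^sup>2) \<le> (\<Sum>i\<in>UNIV. x $ i * (\<Sum>j\<in>UNIV. x $ j))"
      unfolding power2_eq_square using that
      by (intro sum_mono mult_left_mono member_le_sum) (auto simp: less_imp_le)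
    then show "(\<Sum>i\<in>UNIV. (x $ i)\<^sup>2) \<le> (\<Sum>i\<in>UNIV. x $ i)\<^sup>2"
      by (simp add: power2_eq_square sum_distrib_right)
  qed (simp add: sum_nonneg)
  show "has_bochner_integral lborel (\<lambda>x::real^5. exp_weight x * (\<Sum>i\<in>UNIV. (x $ i)\<^sup>2) ^ k)
     (fact k * fps_nth (square_series ^ 5) k)" for k
    using has_bochner_integral_sum_squares_exp[where I = "UNIV :: 5 set" and k = k] by simp
qed

interpretation R0: orthant_form "\<lambda>x::real^5. (\<Sum>i\<in>{2,3,4}. (x $ i)\<^sup>2) + (x $ 0 - x $ 1)\<^sup>2"
  "\<lambda>k. fact k * fps_nth (square_series ^ 4) k"
proof
  show "(\<lambda>x::real^5. (\<Sum>i\<in>{2,3,4}. (x $ i)\<^sup>2) + (x $ 0 - x $ 1)\<^sup>2) \<in> borel_measurable borel"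
    by (intro borel_measurable_continuous_onI continuous_intros)
  show "(\<Sum>i\<in>{2,3,4}. ((t *\<^sub>R x) $ i)\<^sup>2) + ((t *\<^sub>R x) $ 0 - (t *\<^sub>R x) $ 1)\<^sup>2
      = t\<^sup>2 * ((\<Sum>i\<in>{2,3,4}. (x $ i)\<^sup>2) + (x $ 0 - x $ 1)\<^sup>2)" for t and x :: "real^5"
    by (simp add: power2_eq_square algebra_simps)
  show "0 \<le> (\<Sum>i\<in>{2,3,4}. (x $ i)\<^sup>2) + (x $ 0 - x $ 1)\<^sup>2
      \<and> (\<Sum>i\<in>{2,3,4}. (x $ i)\<^sup>2) + (x $ 0 - x $ 1)\<^sup>2 \<le> (\<Sum>i\<in>UNIV. x $ i)\<^sup>2"
    if "x \<in> orthant" for x :: "real^5"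
  proof
    have pos: "0 \<le> x $ i * x $ j" for i j
      using that by (simp add: less_imp_le)
    \<comment> \<open>Only mixed products survive; the first has coefficient 4 because the squared
      difference contributes another 2.\<close>
    have "(\<Sum>i\<in>UNIV. x $ i)\<^sup>2 - ((\<Sum>i\<in>{2,3,4}. (x $ i)\<^sup>2) + (x $ 0 - x $ 1)\<^sup>2)
      = 4 * (x $ 0 * x $ 1) + 2 * (x $ 0 * x $ 2) + 2 * (x $ 0 * x $ 3) + 2 * (x $ 0 * x $ 4)
        + 2 * (x $ 1 * x $ 2) + 2 * (x $ 1 * x $ 3) + 2 * (x $ 1 * x $ 4)
        + 2 * (x $ 2 * x $ 3) + 2 * (x $ 2 * x $ 4) + 2 * (x $ 3 * x $ 4)"
      by (simp add: sum_5 power2_eq_square algebra_simps)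
    also have "\<dots> \<ge> 0"
      by (intro add_nonneg_nonneg mult_nonneg_nonneg[of 4] mult_nonneg_nonneg[of 2] pos) auto
    finally show "(\<Sum>i\<in>{2,3,4}. (x $ i)\<^sup>2) + (x $ 0 - x $ 1)\<^sup>2 \<le> (\<Sum>i\<in>UNIV. x $ i)\<^sup>2"
      by simp
  qed (simp add: sum_nonneg)
  \<comment> \<open>Three squares and one squared difference give the fourth power of the
    series.\<close>
  have "- {2, 3, 4 :: 5} = {0, 1}"
    using UNIV_5 by (auto simp: Compl_eq_Diff_UNIV)
  from has_bochner_integral_sum_squares_diff_exp[OF this]
  show "has_bochner_integral lborel (\<lambda>x::real^5. exp_weight x * ((\<Sum>i\<in>{2,3,4}. (x $ i)\<^sup>2) + (x $ 0 - x $ 1)\<^sup>2) ^ k)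
     (fact k * fps_nth (square_series ^ 4) k)" for k
    by (simp add: eval_nat_numeral del: power_Suc)
qed

section \<open>Enclosures of the solid angles and comparison\<close>

lemma two_powr_5_2: "(2::real) powr (5/2) = sqrt 32"
  by (rule real_sqrt_unique[symmetric]) (simp_all add: powr_power)

lemma solid_angle_R_A5:
  "solid_angle R_A5 = 5 * sqrt 6 * (LINT x|lborel. indicator A5.\<Delta> x * (1 + A5.W x) powr (- (5/2)))"
proof -
  have "solid_angle R_A5 = basis_solid_angle basis_A5"
    using basis_family_if_pos_def_gram[of basis_A5] pos_def_sym_R_A5 solid_angle_gram[of basis_A5]
    by (simp add: gram_basis_A5)
  also have "\<dots> = 5 * (sqrt (3/16) * measure lebesgue {x::real^5. (\<forall>i. 0 < x $ i) \<and> ((A5.s x)\<^sup>2 + (\<Sum>i\<in>UNIV. (x $ i)\<^sup>2)) / 2 \<le> 1})"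
    using basis_solid_angle_eq[OF basis_family_if_pos_def_gram[of basis_A5]] pos_def_sym_R_A5
    unfolding gram_basis_A5 det_R_A5 quadratic_form_R_A5 by simp
  also have "\<dots> = 5 * (sqrt (3/16) * (sqrt 32 * (LINT x|lborel. indicator A5.\<Delta> x * (1 + A5.W x) powr (- (5/2)))))"
    unfolding A5.measure_orthant_le_1 by (simp add: two_powr_5_2)
  also have "\<dots> = 5 * sqrt (3/16 * 32) * (LINT x|lborel. indicator A5.\<Delta> x * (1 + A5.W x) powr (- (5/2)))"
    unfolding real_sqrt_mult by (simp only: mult.assoc)
  finally show ?thesis by simp
qed

lemma solid_angle_R_0:
  "solid_angle R_0 = 10 * (LINT x|lborel. indicator R0.\<Delta> x * (1 + R0.W x) powr (- (5/2)))"
proof -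
  have "solid_angle R_0 = basis_solid_angle basis_0"
    using basis_family_if_pos_def_gram[of basis_0] pos_def_sym_R_0 solid_angle_gram[of basis_0]
    by (simp add: gram_basis_0)
  also have "\<dots> = 5 * (sqrt (1/8) * measure lebesgue {x::real^5. (\<forall>i. 0 < x $ i) \<and>
      ((R0.s x)\<^sup>2 + ((\<Sum>i\<in>{2,3,4}. (x $ i)\<^sup>2) + (x $ 0 - x $ 1)\<^sup>2)) / 2 \<le> 1})"
    using basis_solid_angle_eq[OF basis_family_if_pos_def_gram[of basis_0]] pos_def_sym_R_0
    unfolding gram_basis_0 det_R_0 quadratic_form_R_0 by simp
  also have "\<dots> = 5 * (sqrt (1/8) * (sqrt 32 * (LINT x|lborel. indicator R0.\<Delta> x * (1 + R0.W x) powr (- (5/2)))))"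
    unfolding R0.measure_orthant_le_1 by (simp add: two_powr_5_2)
  also have "\<dots> = 5 * sqrt (1/8 * 32) * (LINT x|lborel. indicator R0.\<Delta> x * (1 + R0.W x) powr (- (5/2)))"
    unfolding real_sqrt_mult by (simp only: mult.assoc)
  finally show ?thesis by simp
qed

lemma solid_angle_R_A5_bounds: "0.05058615 < solid_angle R_A5" "solid_angle R_A5 < 0.05058625"
proof -
  let ?I = "LINT x|lborel. indicator A5.\<Delta> x * (1 + A5.W x) powr (- (5/2))"
  have le: "(13::nat) \<le> 21" "(15::nat) \<le> 21"
    by simp_all
  note bounds =
    A5.powr_integral_bounds(1)[of "5/2" "11/25" 12 13, unfolded powr_coefficients moment_list_eq[OF le(1)]]
    A5.powr_integral_bounds(2)[of "5/2" "11/25" 14 15, unfolded powr_coefficients moment_list_eq[OF le(2)]]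
  have I: "0.0041303425 \<le> ?I"
    by (rule order_trans[OF R_A5_lower_bound bounds(1)]) simp_all
  have I': "?I \<le> 0.0041303450"
    by (rule order_trans[OF bounds(2) R_A5_upper_bound]) simp_all
  \<comment> \<open>Seven decimals are called for: after multiplication by 5 the lower product
    exceeds 0.05058615 by only about 7e-9.\<close>
  have r: "2.4494897 \<le> sqrt 6"
    by (rule real_le_rsqrt) (simp add: power2_eq_square)
  have r': "sqrt 6 \<le> 2.4494898"
    by (rule real_le_lsqrt) (simp_all add: power2_eq_square)
  have "2.4494897 * 0.0041303425 \<le> sqrt 6 * ?I"
    by (rule mult_mono[OF r I]) simp_all
  moreover have "0 \<le> ?I"
    using I by simp
  then have "sqrt 6 * ?I \<le> 2.4494898 * 0.0041303450"
    by (intro mult_mono[OF r' I']) simp_all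
  ultimately show "0.05058615 < solid_angle R_A5" "solid_angle R_A5 < 0.05058625"
    unfolding solid_angle_R_A5 by auto
qed

lemma solid_angle_R_0_bounds: "0.04793605 < solid_angle R_0" "solid_angle R_0 < 0.04793615"
proof -
  let ?I = "LINT x|lborel. indicator R0.\<Delta> x * (1 + R0.W x) powr (- (5/2))"
  have le: "(13::nat) \<le> 21" "(21::nat) \<le> 21"
    by simp_all
  note bounds =
    R0.powr_integral_bounds(1)[of "5/2" "11/25" 12 13, unfolded powr_coefficients moment_list_eq[OF le(1)]]
    R0.powr_integral_bounds(2)[of "5/2" "11/25" 20 21, unfolded powr_coefficients moment_list_eq[OF le(2)]]
  have I: "0.00479361 \<le> ?I"
    by (rule order_trans[OF R_0_lower_bound bounds(1)]) simp_all
  have I': "?I \<le> 0.0047936145"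
    by (rule order_trans[OF bounds(2) R_0_upper_bound]) simp_all
  with I show "0.04793605 < solid_angle R_0" "solid_angle R_0 < 0.04793615"
    unfolding solid_angle_R_0 by auto
qed

theorem mainTheorem2:
  shows "reduced_form R_A5 \<and> reduced_form R_0
    \<and> \<bar>solid_angle R_A5 - 0.0505862\<bar> < 0.00000005
    \<and> \<bar>solid_angle R_0 - 0.0479361\<bar> < 0.00000005
    \<and> solid_angle R_A5 > solid_angle R_0
    \<and> (\<forall>v :: 5 \<Rightarrow> real^5. basis_family v \<and> gram v = R_A5 \<longrightarrow>
         \<not> (\<forall>w :: 5 \<Rightarrow> real^5. reduced_basis w \<longrightarrow> basis_solid_angle v \<le> basis_solid_angle w))"
proof (intro conjI allI impI)
  show less: "solid_angle R_A5 > solid_angle R_0"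
    using solid_angle_R_A5_bounds solid_angle_R_0_bounds by linarith
  show "\<bar>solid_angle R_A5 - 0.0505862\<bar> < 0.00000005"
    using solid_angle_R_A5_bounds unfolding abs_less_iff by (intro conjI) simp_all
  show "\<bar>solid_angle R_0 - 0.0479361\<bar> < 0.00000005"
    using solid_angle_R_0_bounds unfolding abs_less_iff by (intro conjI) simp_all
  fix v :: "5 \<Rightarrow> real^5" assume v: "basis_family v \<and> gram v = R_A5"
  \<comment> \<open>One explicit basis with Gram matrix \<open>R_0\<close> beats every basis with
    Gram matrix \<open>R_A5\<close>, since the angle depends on the Gram matrix alone.\<close>
  have "basis_family basis_0"
    using basis_family_if_pos_def_gram[of basis_0] pos_def_sym_R_0 by (simp add: gram_basis_0)
  then have "reduced_basis basis_0" "basis_solid_angle basis_0 < basis_solid_angle v"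
    using v less solid_angle_gram[of v] solid_angle_gram[of basis_0] reduced_form_R_0
    by (auto simp: reduced_basis_def gram_basis_0)
  then show "\<not> (\<forall>w :: 5 \<Rightarrow> real^5. reduced_basis w \<longrightarrow> basis_solid_angle v \<le> basis_solid_angle w)"
    by (meson not_le)
qed (rule reduced_form_R_A5 reduced_form_R_0)+

end
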